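(* Let $M$ be an MV-effect algebra and let $G(M)$ be the group of all $\phi_M$-preserving automorphisms of the Boolean algebra $B(M)$. For all $u,v\in B(M)$, $u\sim_{G(M)}v$ if and only if $\phi_M(u)=\phi_M(v)$.
   Context: **Effect algebras.** An effect algebra is a partial algebra $(E;\oplus,0,1)$ with a binary partial operation $\oplus$ and constants $0,1$ such that: (E1) if $a\oplus b$ is defined, then $b\oplus a$ is defined and $a\oplus b=b\oplus a$; (E2) if $a\oplus b$ and $(a\oplus b)\oplus c$ are defined, then $b\oplus c$ and $a\oplus(b\oplus c)$ are defined and $(a\oplus b)\oplus c=a\oplus(b\oplus c)$; (E3) for every $a$ there is a unique $a'$ with $a\oplus a'=1$; (E4) if $a\oplus 1$ is defined, then $a=0$. One writes $a\le b$ iff there is $c$ with $a\oplus c=b$; this is a partial order with least element $0$ and greatest element $1$, and the element $c$ is unique and denoted $b\ominus a$. **MV-effect algebras.** An MV-effect algebra is an effect algebra $M$ which is a lattice in the order $\le$ and satisfies $(a\lor b)\ominus a=b\ominus(a\land b)$ for all $a,b\in M$. As a lattice, $M$ is a bounded distributive lattice. **R-generated Boolean algebra and $\phi_M$.** For a bounded distributive lattice $D$, $B(D)$ denotes the (unique up to isomorphism) Boolean algebra such that $D$ is a $0,1$-sublattice of $B(D)$ and $D$ generates $B(D)$ as a Boolean algebra. Every $x\in B(D)$ has a $D$-chain representation of even length: a finite chain $x_1\le\dots\le x_{2n}$ in $D$ with $x=x_1+\dots+x_{2n}$, where $+$ is symmetric difference. For an MV-effect algebra $M$, $B(M)$ is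 the Boolean algebra R-generated by the lattice $M$ in this sense, and $\phi_M:B(M)\to M$ is given by $\phi_M(x)=\bigoplus_{i=1}^n(x_{2i}\ominus x_{2i-1})$, where $\{x_i\}_{i=1}^{2n}$ is any $M$-chain representation of $x$ and $\oplus,\ominus$ are taken in $M$. It is known that the value does not depend on the representation and that $\phi_M$ is a surjective morphism of effect algebras (i.e. $\phi_M(1)=1$, and if $x\wedge y=0$ in $B(M)$ then $\phi_M(x)\oplus\phi_M(y)$ exists in $M$ and equals $\phi_M(x\vee y)$). **$\phi_M$-preserving.** For $S\subseteq B(M)$, a map $f:S\to B(M)$ is $\phi_M$-preserving iff $\phi_M(f(x))=\phi_M(x)$ for all $x\in S$. **The relation $\sim_G$.** For a subgroup $G$ of the automorphism group of a Boolean algebra $B$ and $a,b\in B$, $a\sim_G b$ means that $b=f(a)$ for some $f\in G$. *)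

theory Defs
  imports Main
begin

section \<open>Effect algebras and MV-effect algebras\<close>

text \<open>
  A partial operation is modelled by an option-valued function: \<^term>\<open>None\<close> means ``undefined''.
  The carrier is the whole type.
\<close>

locale partial_algebra =
  fixes oplus :: "'a \<Rightarrow> 'a \<Rightarrow> 'a option"  (infixl "\<oplus>" 65)
    and zero :: 'a  ("\<zero>")
    and one :: 'a  ("\<one>")
begin

definition le :: "'a \<Rightarrow> 'a \<Rightarrow> bool"  (infix "\<preceq>" 50)
  where "a \<preceq> b \<longleftrightarrow> (\<exists>c. a \<oplus> c = Some b)"

text \<open>Only meaningful if \<open>a \<preceq> b\<close>.\<close>

definition ominus :: "'a \<Rightarrow> 'a \<Rightarrow> 'a"  (infixl "\<ominus>" 65)
  where "b \<ominus> a = (THE c. a \<oplus> c = Some b)"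

definition is_meet :: "'a \<Rightarrow> 'a \<Rightarrow> 'a \<Rightarrow> bool"
  where "is_meet a b m \<longleftrightarrow> m \<preceq> a \<and> m \<preceq> b \<and> (\<forall>c. c \<preceq> a \<and> c \<preceq> b \<longrightarrow> c \<preceq> m)"

definition is_join :: "'a \<Rightarrow> 'a \<Rightarrow> 'a \<Rightarrow> bool"
  where "is_join a b j \<longleftrightarrow> a \<preceq> j \<and> b \<preceq> j \<and> (\<forall>c. a \<preceq> c \<and> b \<preceq> c \<longrightarrow> j \<preceq> c)"

definition meet :: "'a \<Rightarrow> 'a \<Rightarrow> 'a"  (infixl "\<curlywedge>" 70)
  where "a \<curlywedge> b = (THE m. is_meet a b m)"

definition join :: "'a \<Rightarrow> 'a \<Rightarrow> 'a"  (infixl "\<curlyvee>" 68)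
  where "a \<curlyvee> b = (THE j. is_join a b j)"

primrec osum :: "'a list \<Rightarrow> 'a option" where
  "osum [] = Some \<zero>"
| "osum (a # as) = Option.bind (osum as) (\<lambda>s. a \<oplus> s)"

end

locale effect_algebra = partial_algebra +
  assumes E1: "a \<oplus> b = Some c \<Longrightarrow> b \<oplus> a = Some c"
    and E2: "a \<oplus> b = Some ab \<Longrightarrow> ab \<oplus> c = Some abc \<Longrightarrow>
      \<exists>bc. b \<oplus> c = Some bc \<and> a \<oplus> bc = Some abc"
    and E3: "\<exists>!a'. a \<oplus> a' = Some \<one>"
    and E4: "a \<oplus> \<one> \<noteq> None \<Longrightarrow> a = \<zero>"

locale mv_effect_algebra = effect_algebra +
  assumes ex_meet: "\<exists>m. is_meet a b m"
    and ex_join: "\<exists>j. is_join a b j"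
    and mv: "(a \<curlyvee> b) \<ominus> a = b \<ominus> (a \<curlywedge> b)"


section \<open>Boolean algebras\<close>

unbundle lattice_syntax

definition sym_diff :: "'b::boolean_algebra \<Rightarrow> 'b \<Rightarrow> 'b"
  where "sym_diff x y = (x \<sqinter> - y) \<squnion> (- x \<sqinter> y)"

inductive_set boolean_closure :: "'b::boolean_algebra set \<Rightarrow> 'b set"
  for X :: "'b set" where
  base: "x \<in> X \<Longrightarrow> x \<in> boolean_closure X"
| bot: "\<bottom> \<in> boolean_closure X"
| top: "\<top> \<in> boolean_closure X"
| inf: "x \<in> boolean_closure X \<Longrightarrow> y \<in> boolean_closure X \<Longrightarrow> x \<sqinter> y \<in> boolean_closure X"
| sup: "x \<in> boolean_closure X \<Longrightarrow> y \<in> boolean_closure X \<Longrightarrow> x \<squnion> y \<in> boolean_closure X"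
| compl: "x \<in> boolean_closure X \<Longrightarrow> - x \<in> boolean_closure X"

text \<open>
  The type \<open>'b\<close>, together with the embedding \<open>e\<close>, is a Boolean algebra R-generated by the lattice
  with the given operations: \<open>e\<close> identifies the lattice with a \<open>0,1\<close>-sublattice that generates the
  whole Boolean algebra. This determines \<open>('b, e)\<close> up to isomorphism over the lattice.
\<close>

definition R_generates ::
  "('a \<Rightarrow> 'a \<Rightarrow> 'a) \<Rightarrow> ('a \<Rightarrow> 'a \<Rightarrow> 'a) \<Rightarrow> 'a \<Rightarrow> 'a \<Rightarrow> ('a \<Rightarrow> 'b::boolean_algebra) \<Rightarrow> bool"
  where "R_generates meet join zero one e \<longleftrightarrow>
    inj e \<and> e zero = \<bottom> \<and> e one = \<top> \<and>
    (\<forall>a b. e (meet a b) = e a \<sqinter> e b) \<and> (\<forall>a b. e (join a b) = e a \<squnion> e b) \<and>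
    boolean_closure (range e) = UNIV"

definition boolean_automorphism :: "('b::boolean_algebra \<Rightarrow> 'b) \<Rightarrow> bool"
  where "boolean_automorphism f \<longleftrightarrow>
    bij f \<and> f \<bottom> = \<bottom> \<and> f \<top> = \<top> \<and>
    (\<forall>x y. f (x \<sqinter> y) = f x \<sqinter> f y) \<and> (\<forall>x y. f (x \<squnion> y) = f x \<squnion> f y) \<and>
    (\<forall>x. f (- x) = - f x)"

text \<open>Used for sets \<open>G\<close> of automorphisms that form a group under composition.\<close>

definition group_sim :: "('b \<Rightarrow> 'b) set \<Rightarrow> 'b \<Rightarrow> 'b \<Rightarrow> bool"
  where "group_sim G a b \<longleftrightarrow> (\<exists>f\<in>G. b = f a)"

lemma boolean_automorphism_id: "boolean_automorphism id"
  by (simp add: boolean_automorphism_def)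

lemma boolean_automorphism_comp:
  "boolean_automorphism f \<Longrightarrow> boolean_automorphism g \<Longrightarrow> boolean_automorphism (f \<circ> g)"
  by (auto simp: boolean_automorphism_def intro: bij_comp)

lemma boolean_automorphism_inv:
  assumes "boolean_automorphism f"
  shows "boolean_automorphism (inv f)"
proof -
  have b: "bij f"
    using assms by (simp add: boolean_automorphism_def)
  have f [simp]: "f (inv f x) = x" for x
    using b by (simp add: bij_is_surj surj_f_inv_f)
  have eq: "inv f x = y \<longleftrightarrow> x = f y" for x y
    using b by (metis bij_inv_eq_iff)
  show ?thesis
    using assms b by (auto simp: boolean_automorphism_def bij_imp_bij_inv eq)
qed


section \<open>The map \<open>\<phi>\<^sub>M\<close> and the group \<open>G(M)\<close>\<close>

locale mv_effect_algebra_R_generated = mv_effect_algebra oplus zero one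
  for oplus :: "'a \<Rightarrow> 'a \<Rightarrow> 'a option"  (infixl "\<oplus>" 65)
    and zero :: 'a  ("\<zero>")
    and one :: 'a  ("\<one>") +
  fixes e :: "'a \<Rightarrow> 'b::boolean_algebra"
  assumes R_generates: "R_generates meet join \<zero> \<one> e"
begin

definition chain_representation :: "'a list \<Rightarrow> 'b \<Rightarrow> bool"
  where "chain_representation xs x \<longleftrightarrow>
    even (length xs) \<and> sorted_wrt (\<preceq>) xs \<and> x = foldr sym_diff (map e xs) \<bottom>"

text \<open>Lists are indexed from \<open>0\<close>, so that \<open>x\<^bsub>2i\<^esub> \<ominus> x\<^bsub>2i-1\<^esub>\<close> becomes \<open>xs ! (2i+1) \<ominus> xs ! (2i)\<close>.\<close>

definition phi :: "'b \<Rightarrow> 'a"  ("\<phi>")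
  where "\<phi> x = (THE m. \<exists>xs. chain_representation xs x \<and>
    osum (map (\<lambda>i. xs ! (2 * i + 1) \<ominus> xs ! (2 * i)) [0..<length xs div 2]) = Some m)"

definition phi_preserving :: "'b set \<Rightarrow> ('b \<Rightarrow> 'b) \<Rightarrow> bool"
  where "phi_preserving S f \<longleftrightarrow> (\<forall>x\<in>S. \<phi> (f x) = \<phi> x)"

definition G :: "('b \<Rightarrow> 'b) set"
  where "G = {f. boolean_automorphism f \<and> phi_preserving UNIV f}"

lemma G_id: "id \<in> G"
  by (simp add: G_def phi_preserving_def boolean_automorphism_id)

lemma G_comp: "f \<in> G \<Longrightarrow> g \<in> G \<Longrightarrow> f \<circ> g \<in> G"
  by (simp add: G_def phi_preserving_def boolean_automorphism_comp)

lemma G_inv: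
  assumes "f \<in> G"
  shows "inv f \<in> G"
proof -
  have "f (inv f x) = x" for x
    using assms by (simp add: G_def boolean_automorphism_def bij_is_surj surj_f_inv_f)
  then have "\<phi> (inv f x) = \<phi> x" for x
    using assms by (metis (mono_tags, lifting) G_def UNIV_I mem_Collect_eq phi_preserving_def)
  then show ?thesis
    using assms by (simp add: G_def phi_preserving_def boolean_automorphism_inv)
qed

end

end

(*
  Call x and y equivalent if there is a phi-preserving order isomorphism between the intervals
  below x and below y in B(M).  For a <= b in M, subtracting a is a lattice isomorphism from the
  interval [a, b] of M onto the interval below c, where c is the difference of b and a in M.  It
  extends to the generated Boolean algebras, so the relative complement of a in b, formed in B(M),
  is equivalent to c.  Every u in B(M) is a disjoint union of such relative complements; placing
  the corresponding differences on top of each other shows that u is equivalent to phi u.  If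
  phi u = phi v, then phi (-u) = phi (-v) by cancellation.  Hence u and v are equivalent and so are
  their complements, and the two isomorphisms glue to an automorphism taking u to v.

  The additivity of phi and the extension of lattice homomorphisms are instances of one statement:
  a valuation on a generating sublattice, with values in a commutative monoid, extends additively
  to the whole Boolean algebra.
*)

theory Submission
  imports Defs
begin

section \<open>Boolean identities via Stone's theorem\<close>

text \<open>These are the homomorphisms into the two-element algebra, or equivalently the indicator
  functions of ultrafilters; meet and complement determine the remaining operations.\<close>

definition boolean_character :: "('b::boolean_algebra \<Rightarrow> bool) \<Rightarrow> bool"
  where "boolean_character \<chi> \<longleftrightarrow>
    (\<forall>x y. \<chi> (x \<sqinter> y) \<longleftrightarrow> \<chi> x \<and> \<chi> y) \<and> (\<forall>x. \<chi> (- x) \<longleftrightarrow> \<not> \<chi> x)"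

definition proper_filter :: "'b::boolean_algebra set \<Rightarrow> bool"
  where "proper_filter F \<longleftrightarrow>
    \<top> \<in> F \<and> \<bottom> \<notin> F \<and> (\<forall>x\<in>F. \<forall>y\<in>F. x \<sqinter> y \<in> F) \<and> (\<forall>x\<in>F. \<forall>y. x \<le> y \<longrightarrow> y \<in> F)"

text \<open>Zorn's lemma on the proper filters containing \<open>a\<close>. A maximal one decides
  every \<open>x\<close>: if it misses \<open>- x\<close>, adjoining \<open>x\<close> keeps it
  proper, so \<open>x\<close> is already in it.\<close>

lemma exists_ultrafilter:
  fixes a :: "'b::boolean_algebra"
  assumes "a \<noteq> \<bottom>"
  shows "\<exists>U. proper_filter U \<and> a \<in> U \<and> (\<forall>x. x \<in> U \<or> - x \<in> U)"
proof -
  define A where "A = {F. proper_filter F \<and> a \<in> F}"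
  have "{x. a \<le> x} \<in> A"
    using assms order_trans[of a] bot_unique[of a] by (simp add: A_def proper_filter_def)
  then have "A \<noteq> {}" by blast
  moreover have "\<Union>C \<in> A" if "C \<noteq> {}" "subset.chain A C" for C
  proof -
    have C: "proper_filter F" "a \<in> F" if "F \<in> C" for F
      using that \<open>subset.chain A C\<close> by (auto simp: subset.chain_def A_def)
    have lin: "F \<subseteq> F' \<or> F' \<subseteq> F" if "F \<in> C" "F' \<in> C" for F F'
      using that \<open>subset.chain A C\<close> by (auto simp: subset.chain_def)
    have "x \<sqinter> y \<in> \<Union>C" if F: "x \<in> F" "F \<in> C" and F': "y \<in> F'" "F' \<in> C" for x y F F'
      using lin[OF F(2) F'(2)]
    proof
      assume "F \<subseteq> F'"
      then have "x \<sqinter> y \<in> F'" using F F' C[of F'] by (auto simp: proper_filter_def)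
      then show ?thesis using F' by blast
    next
      assume "F' \<subseteq> F"
      then have "x \<sqinter> y \<in> F" using F F' C[of F] by (auto simp: proper_filter_def)
      then show ?thesis using F by blast
    qed
    moreover have "y \<in> \<Union>C" if "x \<in> F" "F \<in> C" "x \<le> y" for x y F
      using that C(1)[of F] unfolding proper_filter_def by blast
    moreover have "\<top> \<in> \<Union>C" "a \<in> \<Union>C" "\<bottom> \<notin> \<Union>C"
      using C \<open>C \<noteq> {}\<close> by (auto simp: proper_filter_def)
    ultimately show ?thesis by (auto simp: proper_filter_def A_def)
  qed
  ultimately obtain U where "U \<in> A" and max: "\<And>F. F \<in> A \<Longrightarrow> U \<subseteq> F \<Longrightarrow> F = U"
    using subset_Zorn_nonempty[of A] by metis
  then have U: "proper_filter U" "a \<in> U"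
    by (auto simp: A_def)
  have "x \<in> U" if "- x \<notin> U" for x
  proof -
    let ?F = "{w. \<exists>u\<in>U. u \<sqinter> x \<le> w}"
    \<comment> \<open>If \<open>u \<sqinter> x\<close> were \<open>\<bottom>\<close>, then
      \<open>u\<close> would lie below \<open>- x\<close> and force \<open>- x\<close> into
      \<open>U\<close>.\<close>
    have ne: "u \<sqinter> x \<noteq> \<bottom>" if "u \<in> U" for u
      using U that \<open>- x \<notin> U\<close> unfolding proper_filter_def by (metis inf_shunt)
    have "v \<sqinter> w \<in> ?F" if v: "v \<in> ?F" and w: "w \<in> ?F" for v w
    proof -
      obtain s where s: "s \<in> U" "s \<sqinter> x \<le> v" using v by blast
      obtain t where t: "t \<in> U" "t \<sqinter> x \<le> w" using w by blast
      have "s \<sqinter> t \<in> U" using U s t by (simp add: proper_filter_def)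
      moreover have "s \<sqinter> t \<sqinter> x \<le> v \<sqinter> w"
        using s t by (meson inf.bounded_iff inf_le1 inf_le2 order_trans)
      ultimately show ?thesis by blast
    qed
    moreover have "\<bottom> \<notin> ?F" using ne bot_unique by blast
    moreover have "x \<in> ?F" "\<top> \<in> ?F"
      using \<open>proper_filter U\<close> inf_le2[of \<top> x] top_greatest[of "\<top> \<sqinter> x"]
      by (auto simp: proper_filter_def)
    moreover have sub: "U \<subseteq> ?F"
      using inf_le1[of _ x] by blast
    moreover have "w \<in> ?F" if "v \<in> ?F" "v \<le> w" for v w
      using that order_trans by blast
    ultimately have "proper_filter ?F" by (simp add: proper_filter_def)
    with U sub have "?F \<in> A" by (auto simp: A_def)
    from max[OF this sub] \<open>x \<in> ?F\<close> show ?thesis by simp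
  qed
  with U show ?thesis by blast
qed

text \<open>The Stone representation. \<open>stone \<top>\<close> is the space of all characters, so
  relativising quantifiers and complements to it loses nothing.\<close>

definition stone :: "'b::boolean_algebra \<Rightarrow> ('b \<Rightarrow> bool) set"
  where "stone x = {\<chi>. boolean_character \<chi> \<and> \<chi> x}"

lemma stone_inf: "\<chi> \<in> stone (x \<sqinter> y) \<longleftrightarrow> \<chi> \<in> stone x \<and> \<chi> \<in> stone y"
  by (auto simp: stone_def boolean_character_def)

lemma stone_compl: "\<chi> \<in> stone (- x) \<longleftrightarrow> \<chi> \<in> stone \<top> \<and> \<chi> \<notin> stone x"
proof -
  have "\<chi> \<top>" if "boolean_character \<chi>"
    using that by (metis boolean_character_def inf_top_left)
  then show ?thesis by (auto simp: stone_def boolean_character_def)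
qed

lemma stone_diff: "\<chi> \<in> stone (x - y) \<longleftrightarrow> \<chi> \<in> stone x \<and> \<chi> \<notin> stone y"
  by (auto simp: stone_def boolean_character_def diff_eq)

lemma stone_bot: "\<chi> \<in> stone \<bottom> \<longleftrightarrow> False"
  using stone_diff[of \<chi> \<bottom> \<bottom>] by (simp add: diff_eq)

lemma stone_sup: "\<chi> \<in> stone (x \<squnion> y) \<longleftrightarrow> \<chi> \<in> stone x \<or> \<chi> \<in> stone y"
proof -
  have "\<chi> (- (- x \<sqinter> - y)) \<longleftrightarrow> \<chi> x \<or> \<chi> y" if "boolean_character \<chi>"
    using that unfolding boolean_character_def by (simp del: compl_inf)
  then show ?thesis by (auto simp: stone_def)
qed

text \<open>A failure of \<open>x \<le> y\<close> makes \<open>x - y\<close> nonzero; an ultrafilter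
  containing it, read as a character, satisfies \<open>x\<close> and refutes
  \<open>y\<close>.\<close>

lemma le_iff_stone: "x \<le> y \<longleftrightarrow> (\<forall>\<chi>\<in>stone \<top>. \<chi> \<in> stone x \<longrightarrow> \<chi> \<in> stone y)"
proof
  assume "x \<le> y"
  then show "\<forall>\<chi>\<in>stone \<top>. \<chi> \<in> stone x \<longrightarrow> \<chi> \<in> stone y"
    by (metis inf.orderE stone_inf)
next
  assume sub: "\<forall>\<chi>\<in>stone \<top>. \<chi> \<in> stone x \<longrightarrow> \<chi> \<in> stone y"
  show "x \<le> y"
  proof (rule ccontr)
    assume "\<not> x \<le> y"
    then have "x - y \<noteq> \<bottom>" by (simp add: diff_eq inf_shunt)
    then obtain U where U: "proper_filter U" "x - y \<in> U" "\<And>w. w \<in> U \<or> - w \<in> U"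
      using exists_ultrafilter by blast
    have "\<not> (w \<in> U \<and> - w \<in> U)" for w
      using U(1) unfolding proper_filter_def by (metis inf_compl_bot)
    moreover have "v \<sqinter> w \<in> U \<longleftrightarrow> v \<in> U \<and> w \<in> U" for v w
      using U(1) unfolding proper_filter_def by (meson inf_le1 inf_le2)
    ultimately have "(\<lambda>w. w \<in> U) \<in> stone (x - y)" "(\<lambda>w. w \<in> U) \<in> stone \<top>"
      using U unfolding stone_def boolean_character_def proper_filter_def by auto
    then show False using sub by (auto simp: stone_diff)
  qed
qed

lemma eq_iff_stone:
  "x = y \<longleftrightarrow> (\<forall>\<chi>\<in>stone \<top>. (\<chi> \<in> stone x \<longrightarrow> \<chi> \<in> stone y) \<and> (\<chi> \<in> stone y \<longrightarrow> \<chi> \<in> stone x))"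
  unfolding order.eq_iff[of x y] le_iff_stone[of x y] le_iff_stone[of y x] by blast

text \<open>
  Unfolding these equations turns a Boolean identity, or an implication between Boolean
  inequalities, into a problem of pure logic.
\<close>

lemmas stone = le_iff_stone eq_iff_stone stone_inf stone_sup stone_diff stone_bot stone_compl

section \<open>Extending valuations from a generating sublattice\<close>

locale generating_sublattice =
  fixes L :: "'b::boolean_algebra set"
  assumes bot_mem: "\<bottom> \<in> L" and top_mem: "\<top> \<in> L"
    and inf_mem: "x \<in> L \<Longrightarrow> y \<in> L \<Longrightarrow> x \<sqinter> y \<in> L"
    and sup_mem: "x \<in> L \<Longrightarrow> y \<in> L \<Longrightarrow> x \<squnion> y \<in> L"
    and generates: "boolean_closure L = UNIV"

text \<open>The monoid may lack cancellation, so the data are the increments \<open>d x y\<close>,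
  meant as the value of \<open>y - x\<close>, instead of values of single elements;
  \<open>d_sup\<close> is the modular law. The monoids used later are the one-element monoid, a
  Boolean algebra under join, and the partial sum made total.\<close>

locale lattice_valuation = generating_sublattice L + comm_monoid f z
  for L :: "'b::boolean_algebra set"
    and f :: "'c \<Rightarrow> 'c \<Rightarrow> 'c"  (infixl "\<^bold>*" 70) and z :: 'c  ("\<^bold>1") +
  fixes d :: "'b \<Rightarrow> 'b \<Rightarrow> 'c"
  assumes d_self: "x \<in> L \<Longrightarrow> d x x = \<^bold>1"
    and d_trans: "x \<in> L \<Longrightarrow> y \<in> L \<Longrightarrow> w \<in> L \<Longrightarrow> x \<le> y \<Longrightarrow> y \<le> w \<Longrightarrow> d x y \<^bold>* d y w = d x w"
    and d_sup: "x \<in> L \<Longrightarrow> y \<in> L \<Longrightarrow> d x (x \<squnion> y) = d (x \<sqinter> y) y"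
begin

text \<open>
  \<open>chain_value p q x m\<close>: there is a chain in \<open>L\<close> from \<open>p\<close> to \<open>q\<close> such that \<open>x\<close> is the union of some
  of its steps, and \<open>m\<close> is the total value of these steps.
\<close>

inductive chain_value :: "'b \<Rightarrow> 'b \<Rightarrow> 'b \<Rightarrow> 'c \<Rightarrow> bool" where
  start: "p \<in> L \<Longrightarrow> chain_value p p \<bottom> \<^bold>1"
| skip: "chain_value p q x m \<Longrightarrow> r \<in> L \<Longrightarrow> q \<le> r \<Longrightarrow> chain_value p r x m"
| add: "chain_value p q x m \<Longrightarrow> r \<in> L \<Longrightarrow> q \<le> r \<Longrightarrow> chain_value p r (x \<squnion> (r - q)) (m \<^bold>* d q r)"

section \<open>Existence of chain decompositions\<close>

lemma chain_value_bounds: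
  "chain_value p q x m \<Longrightarrow> p \<in> L \<and> q \<in> L \<and> p \<le> q \<and> x \<le> q - p"
proof (induction rule: chain_value.induct)
  case (skip p q x m r)
  then have "p \<le> r \<and> x \<le> r - p" unfolding stone by blast
  with skip show ?case by blast
next
  case (add p q x m r)
  then have "p \<le> r \<and> x \<squnion> (r - q) \<le> r - p" unfolding stone by blast
  with add show ?case by blast
qed auto

lemma chain_value_append:
  "chain_value q r y n \<Longrightarrow> chain_value p q x m \<Longrightarrow> chain_value p r (x \<squnion> y) (m \<^bold>* n)"
proof (induction arbitrary: x m rule: chain_value.induct)
  case (start p)
  then show ?case by simp
next
  case (skip p q x m r)
  then show ?case by (blast intro: chain_value.skip)
next
  case (add q r y n s)
  from chain_value.add[OF add.IH[OF add.prems] add.hyps(2,3)]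
  show ?case by (simp add: ac_simps)
qed

text \<open>Selecting exactly the skipped steps of the same chain yields the relative complement;
  the two values together telescope to \<open>d p q\<close>.\<close>

lemma chain_value_compl:
  "chain_value p q x m \<Longrightarrow> \<exists>n. chain_value p q (q - p - x) n \<and> m \<^bold>* n = d p q"
proof (induction rule: chain_value.induct)
  case (start p)
  have eq: "p - p - \<bottom> = \<bottom>" unfolding stone by blast
  show ?case
    unfolding eq using chain_value.start[OF start] d_self[OF start] by auto
next
  case (skip p q x m r)
  then obtain n where n: "chain_value p q (q - p - x) n" "m \<^bold>* n = d p q" by blast
  note b = chain_value_bounds[OF skip.hyps(1)]
  have "q - p - x \<squnion> (r - q) = r - p - x"
    using b skip.hyps(3) unfolding stone by blast
  moreover have "m \<^bold>* (n \<^bold>* d q r) = d p r"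
    using n b skip.hyps d_trans by (metis assoc)
  ultimately show ?case
    using chain_value.add[OF n(1) skip.hyps(2,3)] by auto
next
  case (add p q x m r)
  then obtain n where n: "chain_value p q (q - p - x) n" "m \<^bold>* n = d p q" by blast
  note b = chain_value_bounds[OF add.hyps(1)]
  have "q - p - x = r - p - (x \<squnion> (r - q))"
    using b add.hyps(3) unfolding stone by blast
  moreover have "m \<^bold>* d q r \<^bold>* n = d p r"
    using n b add.hyps d_trans by (metis assoc commute)
  ultimately show ?case
    using chain_value.skip[OF n(1) add.hyps(2,3)] by auto
qed

text \<open>Demanding a chain in every interval with ends in \<open>L\<close>, not only from
  \<open>\<bottom>\<close> to \<open>\<top>\<close>, makes it possible to refine the single steps of
  a given chain.\<close>

definition resolvable :: "'b \<Rightarrow> bool" where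
  "resolvable y \<longleftrightarrow> (\<forall>p\<in>L. \<forall>q\<in>L. p \<le> q \<longrightarrow> (\<exists>m. chain_value p q (y \<sqinter> (q - p)) m))"

lemma resolvable_mem:
  assumes "c \<in> L"
  shows "resolvable c"
  unfolding resolvable_def
proof (intro ballI impI)
  fix p q assume pq: "p \<in> L" "q \<in> L" "p \<le> q"
  \<comment> \<open>This is \<open>c\<close> truncated to the interval from \<open>p\<close> to
    \<open>q\<close>: the step from \<open>p\<close> to \<open>?c\<close> is selected and the rest
    is skipped.\<close>
  let ?c = "p \<squnion> c \<sqinter> q"
  have mem: "?c \<in> L" by (simp add: pq assms inf_mem sup_mem)
  have "chain_value p ?c (\<bottom> \<squnion> (?c - p)) (\<^bold>1 \<^bold>* d p ?c)"
    by (rule chain_value.add[OF chain_value.start]) (auto simp: pq mem)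
  moreover have "\<bottom> \<squnion> (?c - p) = c \<sqinter> (q - p) \<and> ?c \<le> q"
    using pq(3) unfolding stone by blast
  ultimately show "\<exists>m. chain_value p q (c \<sqinter> (q - p)) m"
    using chain_value.skip[of p ?c _ _ q] pq by auto
qed

lemma resolvable_compl:
  assumes "resolvable y"
  shows "resolvable (- y)"
  unfolding resolvable_def
proof (intro ballI impI)
  fix p q assume "p \<in> L" "q \<in> L" "p \<le> q"
  then obtain m where m: "chain_value p q (y \<sqinter> (q - p)) m"
    using assms resolvable_def by blast
  have "q - p - y \<sqinter> (q - p) = - y \<sqinter> (q - p)" unfolding stone by blast
  with chain_value_compl[OF m] show "\<exists>m. chain_value p q (- y \<sqinter> (q - p)) m" by auto
qed

text \<open>Each selected step is replaced by a chain resolving \<open>y\<close> inside it. The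
  steps selected there go to \<open>x \<sqinter> y\<close>, the others to \<open>x - y\<close>, and
  their values recombine by \<open>chain_value_compl\<close>.\<close>

lemma chain_value_restrict:
  assumes "resolvable y"
  shows "chain_value p q x m \<Longrightarrow>
    \<exists>m1 m2. chain_value p q (x \<sqinter> y) m1 \<and> chain_value p q (x - y) m2 \<and> m = m1 \<^bold>* m2"
proof (induction rule: chain_value.induct)
  case (start p)
  then show ?case
    by (intro exI[of _ "\<^bold>1"]) (simp add: chain_value.start diff_eq)
next
  case (skip p q x m r)
  then show ?case using chain_value.skip by blast
next
  case (add p q x m r)
  then obtain m1 m2 where m: "chain_value p q (x \<sqinter> y) m1" "chain_value p q (x - y) m2" "m = m1 \<^bold>* m2"
    by blast
  obtain n1 where n1: "chain_value q r (y \<sqinter> (r - q)) n1"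
    using assms add.hyps chain_value_bounds resolvable_def by blast
  from chain_value_compl[OF n1] obtain n2
    where n2: "chain_value q r (r - q - y \<sqinter> (r - q)) n2" "n1 \<^bold>* n2 = d q r" by blast
  have eq: "x \<sqinter> y \<squnion> y \<sqinter> (r - q) = (x \<squnion> (r - q)) \<sqinter> y"
    "x - y \<squnion> (r - q - y \<sqinter> (r - q)) = x \<squnion> (r - q) - y"
    unfolding stone by blast+
  have "m \<^bold>* d q r = (m1 \<^bold>* n1) \<^bold>* (m2 \<^bold>* n2)"
    unfolding m(3) n2(2)[symmetric] by (simp add: ac_simps)
  with chain_value_append[OF n1 m(1)] chain_value_append[OF n2(1) m(2)] show ?case
    unfolding eq by blast
qed

lemma resolvable_inf:
  assumes "resolvable x" "resolvable y"
  shows "resolvable (x \<sqinter> y)"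
  unfolding resolvable_def
proof (intro ballI impI)
  fix p q assume "p \<in> L" "q \<in> L" "p \<le> q"
  then obtain m where "chain_value p q (x \<sqinter> (q - p)) m"
    using assms resolvable_def by blast
  from chain_value_restrict[OF assms(2) this]
  show "\<exists>m. chain_value p q (x \<sqinter> y \<sqinter> (q - p)) m"
    by (metis inf.commute inf.left_commute)
qed

lemma all_resolvable: "resolvable x"
proof -
  have "x \<in> boolean_closure L" by (simp add: generates)
  then show ?thesis
  proof (induction rule: boolean_closure.induct)
    case (sup x y)
    have "resolvable (- (- x \<sqinter> - y))"
      by (intro resolvable_compl resolvable_inf sup.IH)
    then show ?case by simp
  qed (auto simp: resolvable_mem bot_mem top_mem resolvable_inf resolvable_compl)
qed

lemma chain_value_exists: "\<exists>m. chain_value \<bottom> \<top> x m"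
  using all_resolvable[of x] bot_mem top_mem by (fastforce simp: resolvable_def diff_eq)

section \<open>Uniqueness of the value of a chain decomposition\<close>

lemma chain_value_bot:
  "chain_value p q x m \<Longrightarrow> x = \<bottom> \<Longrightarrow> m = \<^bold>1"
proof (induction rule: chain_value.induct)
  case (add p q x m r)
  then have "x = \<bottom> \<and> q = r" unfolding stone by blast
  with add show ?case by (simp add: d_self)
qed auto

lemma chain_value_whole:
  "chain_value p q x m \<Longrightarrow> x = q - p \<Longrightarrow> m = d p q"
proof (induction rule: chain_value.induct)
  case (start p)
  then show ?case by (simp add: d_self)
next
  case (skip p q x m r)
  note chain_value_bounds[OF skip.hyps(1)]
  then have "q = r" using skip.prems skip.hyps(3) unfolding stone by blast
  with skip show ?case by simp
next
  case (add p q x m r)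
  note b = chain_value_bounds[OF add.hyps(1)]
  then have "x = q - p" using add.prems add.hyps(3) unfolding stone by blast
  with add.IH b d_trans[of p q r] add.hyps show ?case by simp
qed

text \<open>On the way through \<open>p \<squnion> q \<sqinter> t\<close>, the modular law
  transposes the lower part down to the meets with \<open>t\<close> and the upper part up to the
  joins with \<open>t\<close>.\<close>

lemma d_split:
  assumes mem: "p \<in> L" "q \<in> L" "t \<in> L" and "p \<le> q"
  shows "d p q = d (p \<sqinter> t) (q \<sqinter> t) \<^bold>* d (p \<squnion> t) (q \<squnion> t)"
proof -
  let ?s = "p \<squnion> q \<sqinter> t"
  have "p \<sqinter> (q \<sqinter> t) = p \<sqinter> t" "(p \<squnion> t) \<sqinter> q = ?s" "(p \<squnion> t) \<squnion> q = q \<squnion> t" "?s \<le> q"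
    using \<open>p \<le> q\<close> unfolding stone by blast+
  then show ?thesis
    using d_sup[of p "q \<sqinter> t"] d_sup[of "p \<squnion> t" q] d_trans[of p ?s q] mem
    by (simp add: inf_mem sup_mem)
qed

text \<open>Meeting all members of the chain with \<open>t\<close>, or joining them with
  \<open>t\<close>, gives chains whose selected steps make up \<open>x \<sqinter> t\<close> and
  \<open>x - t\<close>; \<open>d_split\<close> distributes the value of each step.\<close>

lemma chain_value_split:
  assumes "t \<in> L"
  shows "chain_value p q x m \<Longrightarrow>
    \<exists>m1 m2. chain_value (p \<sqinter> t) (q \<sqinter> t) (x \<sqinter> t) m1 \<and>
      chain_value (p \<squnion> t) (q \<squnion> t) (x - t) m2 \<and> m = m1 \<^bold>* m2"
proof (induction rule: chain_value.induct)
  case (start p)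
  have "chain_value (p \<sqinter> t) (p \<sqinter> t) \<bottom> \<^bold>1" "chain_value (p \<squnion> t) (p \<squnion> t) \<bottom> \<^bold>1"
    using start assms by (auto intro!: chain_value.start inf_mem sup_mem)
  then show ?case by (intro exI[of _ "\<^bold>1"]) (simp add: diff_eq)
next
  case (skip p q x m r)
  have "q \<sqinter> t \<le> r \<sqinter> t" "q \<squnion> t \<le> r \<squnion> t" "r \<sqinter> t \<in> L" "r \<squnion> t \<in> L"
    using skip.hyps assms by (auto intro: inf_mem sup_mem le_infI1 le_supI1)
  with skip.IH show ?case by (blast intro: chain_value.skip)
next
  case (add p q x m r)
  then obtain m1 m2 where m: "chain_value (p \<sqinter> t) (q \<sqinter> t) (x \<sqinter> t) m1"
    "chain_value (p \<squnion> t) (q \<squnion> t) (x - t) m2" "m = m1 \<^bold>* m2"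
    by blast
  have le: "q \<sqinter> t \<le> r \<sqinter> t" "q \<squnion> t \<le> r \<squnion> t" "r \<sqinter> t \<in> L" "r \<squnion> t \<in> L"
    using add.hyps assms by (auto intro: inf_mem sup_mem le_infI1 le_supI1)
  have eq: "x \<sqinter> t \<squnion> (r \<sqinter> t - q \<sqinter> t) = (x \<squnion> (r - q)) \<sqinter> t"
    "x - t \<squnion> (r \<squnion> t - (q \<squnion> t)) = x \<squnion> (r - q) - t"
    unfolding stone by blast+
  have "m \<^bold>* d q r = (m1 \<^bold>* d (q \<sqinter> t) (r \<sqinter> t)) \<^bold>* (m2 \<^bold>* d (q \<squnion> t) (r \<squnion> t))"
    using d_split[of q r t] add.hyps chain_value_bounds[OF add.hyps(1)] assms m(3)
    by (simp add: ac_simps)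
  with chain_value.add[OF m(1) le(3,1)] chain_value.add[OF m(2) le(4,2)] show ?case
    unfolding eq by blast
qed

text \<open>Cutting at \<open>b\<close> and then at \<open>a\<close> leaves one piece that runs
  exactly from \<open>a\<close> to \<open>b\<close> with everything selected; the other two pieces
  are \<open>\<bottom>\<close> and have trivial value.\<close>

lemma chain_value_diff:
  assumes "chain_value p q (b - a) m" "a \<in> L" "b \<in> L" "a \<le> b"
  shows "m = d a b"
proof -
  obtain m1 m2 where 1: "chain_value (p \<sqinter> b) (q \<sqinter> b) ((b - a) \<sqinter> b) m1"
    "chain_value (p \<squnion> b) (q \<squnion> b) (b - a - b) m2" "m = m1 \<^bold>* m2"
    using chain_value_split[OF \<open>b \<in> L\<close> assms(1)] by blast
  have "b - a - b = \<bottom>" unfolding stone by blast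
  with 1 have "m2 = \<^bold>1" using chain_value_bot by blast
  obtain n1 n2 where 2: "chain_value (p \<sqinter> b \<sqinter> a) (q \<sqinter> b \<sqinter> a) ((b - a) \<sqinter> b \<sqinter> a) n1"
    "chain_value (p \<sqinter> b \<squnion> a) (q \<sqinter> b \<squnion> a) ((b - a) \<sqinter> b - a) n2" "m1 = n1 \<^bold>* n2"
    using chain_value_split[OF \<open>a \<in> L\<close> 1(1)] by blast
  have "(b - a) \<sqinter> b \<sqinter> a = \<bottom>" unfolding stone by blast
  with 2 have "n1 = \<^bold>1" using chain_value_bot by blast
  have "p \<sqinter> b \<squnion> a = a \<and> q \<sqinter> b \<squnion> a = b \<and> (b - a) \<sqinter> b - a = b - a"
    using chain_value_bounds[OF assms(1)] \<open>a \<le> b\<close> unfolding stone by blast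
  with 2 have "n2 = d a b" using chain_value_whole by simp
  with 1 2 \<open>m2 = \<^bold>1\<close> \<open>n1 = \<^bold>1\<close> show ?thesis by simp
qed

text \<open>Induction on the first chain. At a selected step the second chain is cut at
  \<open>q\<close>: its lower part represents \<open>x\<close> and falls to the induction
  hypothesis, its upper part represents \<open>r - q\<close> and is evaluated by
  \<open>chain_value_diff\<close>. Cutting moves the ends, hence the generalisation over
  \<open>p'\<close> and \<open>q'\<close>.\<close>

lemma chain_value_unique:
  "chain_value p q x m \<Longrightarrow> chain_value p' q' x m' \<Longrightarrow> m = m'"
proof (induction arbitrary: p' q' m' rule: chain_value.induct)
  case (start p)
  then show ?case using chain_value_bot by blast
next
  case (skip p q x m r)
  then show ?case by blast
next
  case (add p q x m r)
  note b = chain_value_bounds[OF add.hyps(1)]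
  obtain m1 m2 where m: "chain_value (p' \<sqinter> q) (q' \<sqinter> q) ((x \<squnion> (r - q)) \<sqinter> q) m1"
    "chain_value (p' \<squnion> q) (q' \<squnion> q) (x \<squnion> (r - q) - q) m2" "m' = m1 \<^bold>* m2"
    using chain_value_split[OF _ add.prems, of q] b by blast
  have "(x \<squnion> (r - q)) \<sqinter> q = x \<and> x \<squnion> (r - q) - q = r - q"
    using b unfolding stone by blast
  with m add.IH chain_value_diff[of _ _ r q m2] b add.hyps show ?case by auto
qed

section \<open>The additive extension of a valuation\<close>

definition extension :: "'b \<Rightarrow> 'c" where
  "extension x = (THE m. chain_value \<bottom> \<top> x m)"

lemma extension_eq:
  assumes "chain_value p q x m"
  shows "extension x = m"
  unfolding extension_def
proof (rule the_equality)
  show "chain_value \<bottom> \<top> x m"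
    using chain_value_exists[of x] chain_value_unique[OF assms] by blast
qed (use chain_value_unique[OF assms] in blast)

lemma extension_bot: "extension \<bottom> = \<^bold>1"
  using extension_eq chain_value.start[OF bot_mem] .

lemma extension_diff:
  assumes "a \<in> L" "b \<in> L" "a \<le> b"
  shows "extension (b - a) = d a b"
  using extension_eq[OF chain_value.add[OF chain_value.start]] assms by simp

text \<open>A chain for the union is refined by \<open>x\<close>; by disjointness the two resulting
  parts are \<open>x\<close> and \<open>y\<close>, and uniqueness identifies their values.\<close>

lemma extension_sup:
  assumes "x \<sqinter> y = \<bottom>"
  shows "extension (x \<squnion> y) = extension x \<^bold>* extension y"
proof -
  obtain m where "chain_value \<bottom> \<top> (x \<squnion> y) m" using chain_value_exists by blast
  from chain_value_restrict[OF all_resolvable[of x] this]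
  obtain m1 m2 where "chain_value \<bottom> \<top> ((x \<squnion> y) \<sqinter> x) m1" "chain_value \<bottom> \<top> (x \<squnion> y - x) m2"
    "m = m1 \<^bold>* m2" by blast
  moreover have "(x \<squnion> y) \<sqinter> x = x \<and> x \<squnion> y - x = y" using assms unfolding stone by blast
  ultimately show ?thesis
    using extension_eq \<open>chain_value \<bottom> \<top> (x \<squnion> y) m\<close> by metis
qed

end

section \<open>Induction along chains and extension of lattice homomorphisms\<close>

context generating_sublattice
begin

text \<open>The valuation into the one-element monoid retains only the existence of chains. The
  first argument of \<open>P\<close> is the current upper end, which bounds what has been built so
  far.\<close>

lemma chain_induct:
  assumes "P \<bottom> \<bottom>"
    and skip: "\<And>q r x. q \<in> L \<Longrightarrow> r \<in> L \<Longrightarrow> q \<le> r \<Longrightarrow> x \<le> q \<Longrightarrow> P q x \<Longrightarrow> P r x"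
    and add: "\<And>q r x. q \<in> L \<Longrightarrow> r \<in> L \<Longrightarrow> q \<le> r \<Longrightarrow> x \<le> q \<Longrightarrow> P q x \<Longrightarrow> P r (x \<squnion> (r - q))"
  shows "P \<top> x"
proof -
  interpret lattice_valuation L "\<lambda>_ _. ()" "()" "\<lambda>_ _. ()"
    by unfold_locales auto
  have "P q x" if "chain_value p q x m" "p = \<bottom>" for p q x m
    using that
  proof (induction rule: chain_value.induct)
    case (skip p q x m r)
    then show ?case
      using chain_value_bounds[OF skip.hyps(1)] assms(2)[of q r x] by (simp add: diff_eq)
  next
    case (add p q x m r)
    then show ?case
      using chain_value_bounds[OF add.hyps(1)] assms(3)[of q r x] by (simp add: diff_eq)
  qed (simp add: assms(1))
  then show ?thesis using chain_value_exists by blast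
qed

text \<open>The increments \<open>h y - h x\<close> form a valuation into the target algebra under
  join. \<open>H\<close> sends \<open>\<top>\<close> to \<open>h \<top> - h \<bottom>\<close>, which
  may be proper; this suits maps into an interval.\<close>

lemma hom_extension:
  assumes h_sup: "\<And>x y. x \<in> L \<Longrightarrow> y \<in> L \<Longrightarrow> h (x \<squnion> y) = h x \<squnion> h y"
    and h_inf: "\<And>x y. x \<in> L \<Longrightarrow> y \<in> L \<Longrightarrow> h (x \<sqinter> y) = h x \<sqinter> h y"
  obtains H :: "'b \<Rightarrow> 'c::boolean_algebra" where "H \<bottom> = \<bottom>"
    and "\<And>x y. x \<in> L \<Longrightarrow> y \<in> L \<Longrightarrow> x \<le> y \<Longrightarrow> H (y - x) = h y - h x"
    and "\<And>x y. H (x \<squnion> y) = H x \<squnion> H y"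
proof -
  have mono: "h x \<le> h y" if "x \<in> L" "y \<in> L" "x \<le> y" for x y
    using that h_sup by (metis sup.absorb_iff2)
  interpret lattice_valuation L "(\<squnion>)" "\<bottom>" "\<lambda>x y. h y - h x"
  proof unfold_locales
    fix x y w assume *: "x \<in> L" "y \<in> L"
    show "h (x \<squnion> y) - h x = h y - h (x \<sqinter> y)"
      unfolding h_sup[OF *] h_inf[OF *] unfolding stone by blast
    assume "w \<in> L" "x \<le> y" "y \<le> w"
    then have "h x \<le> h y" "h y \<le> h w" using * mono by blast+
    then show "h y - h x \<squnion> (h w - h y) = h w - h x"
      unfolding stone by blast
  next
    fix x show "h x - h x = \<bottom>" unfolding stone by blast
  qed
  have "extension (x \<squnion> y) = extension x \<squnion> extension y" for x y
  proof -
    \<comment> \<open>Additivity is available on disjoint pieces; idempotence of join lets the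
      common piece \<open>x \<sqinter> y\<close> occur twice.\<close>
    have "x \<squnion> y = x \<sqinter> y \<squnion> (x - y \<squnion> (y - x))" "x \<sqinter> y \<sqinter> (x - y \<squnion> (y - x)) = \<bottom>"
      "(x - y) \<sqinter> (y - x) = \<bottom>" "x = x \<sqinter> y \<squnion> (x - y)" "x \<sqinter> y \<sqinter> (x - y) = \<bottom>"
      "y = x \<sqinter> y \<squnion> (y - x)" "x \<sqinter> y \<sqinter> (y - x) = \<bottom>"
      unfolding stone by blast+
    then have "extension (x \<squnion> y) = extension (x \<sqinter> y) \<squnion> (extension (x - y) \<squnion> extension (y - x))"
      "extension x = extension (x \<sqinter> y) \<squnion> extension (x - y)"
      "extension y = extension (x \<sqinter> y) \<squnion> extension (y - x)"
      by (metis extension_sup)+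
    then show ?thesis by (simp add: ac_simps)
  qed
  then show ?thesis using that extension_bot extension_diff by blast
qed

end

text \<open>Mutually inverse monotone maps are adjoint to each other on both sides, so meets and
  joins are preserved; complements follow by their uniqueness.\<close>

lemma boolean_automorphism_if_order_automorphism:
  assumes f: "mono f" and g: "mono g" and gf: "\<And>x. g (f x) = x" and fg: "\<And>x. f (g x) = x"
  shows "boolean_automorphism f"
proof -
  have bij: "bij f" using gf fg by (metis bijI')
  have le: "f x \<le> y \<longleftrightarrow> x \<le> g y" "y \<le> f x \<longleftrightarrow> g y \<le> x" for x y
    using f g gf fg by (metis monoD)+
  have bot: "f \<bottom> = \<bottom>" and top: "f \<top> = \<top>"
    using le(1)[of \<bottom> \<bottom>] le(2)[of \<top> \<top>] by (simp_all add: bot_unique top_unique)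
  have inf: "f (x \<sqinter> y) = f x \<sqinter> f y" for x y
  proof (rule order.antisym)
    have "g (f x \<sqinter> f y) \<le> x" "g (f x \<sqinter> f y) \<le> y" by (simp_all flip: le(2))
    then show "f x \<sqinter> f y \<le> f (x \<sqinter> y)" by (simp add: le(2))
  qed (simp add: monoD[OF f])
  have sup: "f (x \<squnion> y) = f x \<squnion> f y" for x y
  proof (rule order.antisym)
    have "x \<le> g (f x \<squnion> f y)" "y \<le> g (f x \<squnion> f y)" by (simp_all flip: le(1))
    then show "f (x \<squnion> y) \<le> f x \<squnion> f y" by (simp add: le(1))
  qed (simp add: monoD[OF f])
  have "f (- x) = - f x" for x
    by (intro sym[OF compl_unique]) (simp_all add: bot top flip: inf sup)
  with bij bot top inf sup show ?thesis by (simp add: boolean_automorphism_def)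
qed

section \<open>Effect algebras\<close>

context effect_algebra
begin

text \<open>With \<open>c'\<close> the complement of \<open>c\<close>, both
  \<open>b \<oplus> c'\<close> and \<open>b' \<oplus> c'\<close> are complements of
  \<open>a\<close>, hence equal. Regrouping makes \<open>b\<close> and \<open>b'\<close> complements
  of the same element \<open>c' \<oplus> a\<close>, and E3 applies again.\<close>

lemma cancel:
  assumes "a \<oplus> b = Some c" "a \<oplus> b' = Some c"
  shows "b = b'"
proof -
  obtain c' where c': "c \<oplus> c' = Some \<one>" using E3 by blast
  obtain s where s: "b \<oplus> c' = Some s" "a \<oplus> s = Some \<one>" using E2[OF assms(1) c'] by blast
  obtain s' where s': "b' \<oplus> c' = Some s'" "a \<oplus> s' = Some \<one>" using E2[OF assms(2) c'] by blast
  have "s' = s" using E3[of a] s s' by blast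
  with s'(1) have "b' \<oplus> c' = Some s" by simp
  from E2[OF s(1) E1[OF s(2)]] E2[OF this E1[OF s(2)]]
  obtain t where t: "c' \<oplus> a = Some t" "b \<oplus> t = Some \<one>"
    using E2[OF s(1) E1[OF s(2)]] by blast
  moreover have "b' \<oplus> t = Some \<one>"
    using E2[OF \<open>b' \<oplus> c' = Some s\<close> E1[OF s(2)]] t(1) by simp
  ultimately have "t \<oplus> b = Some \<one>" "t \<oplus> b' = Some \<one>" using E1 by fast+
  then show ?thesis using E3[of t] by blast
qed

text \<open>E4 identifies the complement of \<open>\<one>\<close> as \<open>\<zero>\<close>. Adding
  \<open>\<zero>\<close> to \<open>b \<oplus> a\<close>, which is \<open>\<one>\<close>, and
  regrouping reduces the claim to cancellation of \<open>b\<close>.\<close>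

lemma oplus_zero: "a \<oplus> \<zero> = Some a"
proof -
  obtain z where "\<one> \<oplus> z = Some \<one>" using E3 by blast
  with E4[of z] E1[OF this] have one: "\<one> \<oplus> \<zero> = Some \<one>" by simp
  obtain b where b: "a \<oplus> b = Some \<one>" using E3 by blast
  from E2[OF E1[OF b] one] obtain c where c: "a \<oplus> \<zero> = Some c" "b \<oplus> c = Some \<one>" by blast
  with cancel[OF c(2) E1[OF b]] show ?thesis by simp
qed

lemma zero_oplus: "\<zero> \<oplus> a = Some a"
  using E1[OF oplus_zero] .

lemma oplus_eq_zero:
  assumes "a \<oplus> b = Some \<zero>"
  shows "b = \<zero>"
proof -
  from E2[OF assms zero_oplus] have "b \<oplus> \<one> \<noteq> None" by blast
  then show ?thesis by (rule E4)
qed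

definition option_sum :: "'a option \<Rightarrow> 'a option \<Rightarrow> 'a option" where
  "option_sum x y = Option.bind x (\<lambda>a. Option.bind y (\<lambda>b. a \<oplus> b))"

lemma option_sum_Some [simp]: "option_sum (Some a) (Some b) = a \<oplus> b"
  by (simp add: option_sum_def)

lemma oplus_commute: "a \<oplus> b = b \<oplus> a"
  using E1[of a b] E1[of b a] by (cases "a \<oplus> b"; cases "b \<oplus> a") simp_all

text \<open>With \<^term>\<open>None\<close> as an absorbing element, the partial operation becomes a total one.\<close>

lemma comm_monoid_option_sum: "comm_monoid option_sum (Some \<zero>)"
proof
  fix x y w :: "'a option"
  show comm: "option_sum x y = option_sum y x" for x y
    by (cases x; cases y) (auto simp: option_sum_def oplus_commute)
  show "option_sum x (Some \<zero>) = x"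
    by (cases x) (auto simp: option_sum_def oplus_zero)
  have *: "option_sum x (option_sum y w) = Some m"
    if m: "option_sum (option_sum x y) w = Some m" for m x y w
  proof -
    obtain a b c ab where "x = Some a" "y = Some b" "w = Some c" "a \<oplus> b = Some ab" "ab \<oplus> c = Some m"
      using m by (auto simp: option_sum_def bind_eq_Some_conv)
    with E2[of a b ab c m] show ?thesis by auto
  qed
  show "option_sum (option_sum x y) w = option_sum x (option_sum y w)"
  proof (cases "option_sum (option_sum x y) w")
    case None
    show ?thesis
    proof (cases "option_sum x (option_sum y w)")
      case (Some m)
      \<comment> \<open>The remaining case is the mirror image: commutativity rewrites the defined
        right-nested sum as a left-nested one with the summands reversed.\<close>
      have "option_sum (option_sum w y) x = option_sum x (option_sum y w)"
        by (subst comm, subst comm[of w y]) (rule refl)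
      then have "option_sum w (option_sum y x) = Some m" using * Some by simp
      also have "option_sum w (option_sum y x) = option_sum (option_sum x y) w"
        by (subst comm, subst comm[of x y]) (rule refl)
      finally show ?thesis using None by simp
    qed (simp add: None)
  next
    case (Some m)
    from *[OF this] show ?thesis using Some by simp
  qed
qed

lemma oplus_assoc:
  assumes "a \<oplus> b = Some ab" "b \<oplus> c = Some bc"
  shows "ab \<oplus> c = a \<oplus> bc"
proof -
  interpret comm_monoid option_sum "Some \<zero>" by (rule comm_monoid_option_sum)
  show ?thesis using assoc[of "Some a" "Some b" "Some c"] assms by simp
qed

lemma le_refl: "a \<preceq> a"
  using oplus_zero le_def by blast

lemma le_trans: "a \<preceq> b \<Longrightarrow> b \<preceq> c \<Longrightarrow> a \<preceq> c"
  unfolding le_def using E2 by blast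

lemma le_antisym:
  assumes "a \<preceq> b" "b \<preceq> a"
  shows "a = b"
proof -
  obtain c d where c: "a \<oplus> c = Some b" and d: "b \<oplus> d = Some a"
    using assms by (auto simp: le_def)
  from E2[OF c d] obtain s where "c \<oplus> d = Some s" "a \<oplus> s = Some a" by blast
  with cancel[OF _ oplus_zero] have "c \<oplus> d = Some \<zero>" by blast
  then have "d = \<zero>" by (rule oplus_eq_zero)
  with d oplus_zero show ?thesis by simp
qed

lemma ominus_eq: "a \<oplus> c = Some b \<Longrightarrow> b \<ominus> a = c"
  unfolding ominus_def using cancel by blast

lemma oplus_ominus: "a \<preceq> b \<Longrightarrow> a \<oplus> (b \<ominus> a) = Some b"
  using ominus_eq le_def by metis

lemma ominus_self: "a \<ominus> a = \<zero>"
  using ominus_eq oplus_zero by blast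

lemma ominus_zero: "a \<ominus> \<zero> = a"
  using ominus_eq zero_oplus by blast

lemma ominus_oplus_ominus:
  assumes "a \<preceq> b" "b \<preceq> c"
  shows "(b \<ominus> a) \<oplus> (c \<ominus> b) = Some (c \<ominus> a)"
  using E2[OF oplus_ominus[OF assms(1)] oplus_ominus[OF assms(2)]] ominus_eq by fastforce

lemma ominus_le_iff:
  assumes "a \<preceq> x" "a \<preceq> y"
  shows "x \<ominus> a \<preceq> y \<ominus> a \<longleftrightarrow> x \<preceq> y"
proof
  assume "x \<preceq> y"
  with assms show "x \<ominus> a \<preceq> y \<ominus> a" using ominus_oplus_ominus le_def by blast
next
  assume "x \<ominus> a \<preceq> y \<ominus> a"
  then obtain d where "(x \<ominus> a) \<oplus> d = Some (y \<ominus> a)" by (auto simp: le_def)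
  from oplus_assoc[OF oplus_ominus[OF assms(1)] this] show "x \<preceq> y"
    using oplus_ominus[OF assms(2)] by (auto simp: le_def)
qed

lemma is_meet_unique: "is_meet a b m \<Longrightarrow> is_meet a b m' \<Longrightarrow> m = m'"
  unfolding is_meet_def using le_antisym by blast

lemma is_join_unique: "is_join a b m \<Longrightarrow> is_join a b m' \<Longrightarrow> m = m'"
  unfolding is_join_def using le_antisym by blast

end

section \<open>Subtraction of a fixed element as a lattice isomorphism\<close>

context mv_effect_algebra
begin

lemma meet_eq: "is_meet a b m \<Longrightarrow> a \<curlywedge> b = m"
  unfolding meet_def using is_meet_unique by blast

lemma join_eq: "is_join a b m \<Longrightarrow> a \<curlyvee> b = m"
  unfolding join_def using is_join_unique by blast

lemma le_iff_meet: "a \<preceq> b \<longleftrightarrow> a \<curlywedge> b = a"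
  using ex_meet[of a b] meet_eq le_refl unfolding is_meet_def by metis

lemma meet_le: "a \<curlywedge> b \<preceq> a" "a \<curlywedge> b \<preceq> b"
  and le_meet: "c \<preceq> a \<Longrightarrow> c \<preceq> b \<Longrightarrow> c \<preceq> a \<curlywedge> b"
  using ex_meet[of a b] meet_eq unfolding is_meet_def by metis+

lemma le_join: "a \<preceq> a \<curlyvee> b" "b \<preceq> a \<curlyvee> b"
  and join_le: "a \<preceq> c \<Longrightarrow> b \<preceq> c \<Longrightarrow> a \<curlyvee> b \<preceq> c"
  using ex_join[of a b] join_eq unfolding is_join_def by metis+

text \<open>Regrouping places the summand \<open>d\<close> of \<open>x \<ominus> a\<close> next to
  \<open>a\<close>. This is the surjectivity of subtraction that transports meets and joins
  below.\<close>

lemma le_ominusE: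
  assumes "a \<preceq> x" "d \<preceq> x \<ominus> a"
  obtains w where "a \<oplus> d = Some w" "a \<preceq> w" "w \<preceq> x" "d = w \<ominus> a"
proof -
  obtain f where "d \<oplus> f = Some (x \<ominus> a)" using assms(2) by (auto simp: le_def)
  then have f: "f \<oplus> d = Some (x \<ominus> a)" by (rule E1)
  have "(x \<ominus> a) \<oplus> a = Some x" by (rule E1[OF oplus_ominus[OF assms(1)]])
  from E2[OF f this] obtain w where w: "d \<oplus> a = Some w" "f \<oplus> w = Some x" by blast
  from E1[OF w(1)] E1[OF w(2)] show ?thesis
    using that ominus_eq unfolding le_def by blast
qed

lemma ominus_meet:
  assumes "a \<preceq> x" "a \<preceq> y"
  shows "(x \<curlywedge> y) \<ominus> a = (x \<ominus> a) \<curlywedge> (y \<ominus> a)"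
proof (rule sym[OF meet_eq])
  have a: "a \<preceq> x \<curlywedge> y" using assms by (rule le_meet)
  have "d \<preceq> (x \<curlywedge> y) \<ominus> a" if d: "d \<preceq> x \<ominus> a" "d \<preceq> y \<ominus> a" for d
    using le_ominusE[OF assms(1) d(1)] d(2) a assms le_meet ominus_le_iff by metis
  then show "is_meet (x \<ominus> a) (y \<ominus> a) ((x \<curlywedge> y) \<ominus> a)"
    using a assms by (auto simp: is_meet_def ominus_le_iff meet_le)
qed

lemma ominus_join:
  assumes "a \<preceq> x" "a \<preceq> y"
  shows "(x \<curlyvee> y) \<ominus> a = (x \<ominus> a) \<curlyvee> (y \<ominus> a)"
proof (rule sym[OF join_eq])
  have a: "a \<preceq> x \<curlyvee> y" using assms(1) le_join(1) by (rule le_trans)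
  have up: "x \<ominus> a \<preceq> (x \<curlyvee> y) \<ominus> a" "y \<ominus> a \<preceq> (x \<curlyvee> y) \<ominus> a"
    using a assms by (auto simp: ominus_le_iff le_join)
  have "(x \<curlyvee> y) \<ominus> a \<preceq> d" if d: "x \<ominus> a \<preceq> d" "y \<ominus> a \<preceq> d" for d
  proof -
    \<comment> \<open>An upper bound \<open>d\<close> may lie outside the range of subtraction;
      truncation brings it inside and keeps it an upper bound.\<close>
    define d' where "d' = d \<curlywedge> ((x \<curlyvee> y) \<ominus> a)"
    have "d' \<preceq> (x \<curlyvee> y) \<ominus> a" "d' \<preceq> d" by (simp_all add: d'_def meet_le)
    moreover from this(1) obtain w where w: "a \<preceq> w" "w \<preceq> x \<curlyvee> y" "d' = w \<ominus> a"
      using le_ominusE[OF a] by blast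
    have "x \<ominus> a \<preceq> d'" "y \<ominus> a \<preceq> d'" using d up by (simp_all add: d'_def le_meet)
    then have "x \<curlyvee> y \<preceq> w" using w assms by (simp add: ominus_le_iff join_le)
    then have "(x \<curlyvee> y) \<ominus> a \<preceq> d'" using w a by (simp add: ominus_le_iff)
    ultimately show ?thesis using le_trans by blast
  qed
  with up show "is_join (x \<ominus> a) (y \<ominus> a) ((x \<curlyvee> y) \<ominus> a)"
    by (simp add: is_join_def)
qed

end

section \<open>The map \<open>\<phi>\<close> as the additive extension of the difference on
  \<open>M\<close>\<close>

context mv_effect_algebra_R_generated
begin

lemma
  e_inj: "inj e" and e_zero: "e \<zero> = \<bottom>" and e_one: "e \<one> = \<top>"
  and e_meet: "e (a \<curlywedge> b) = e a \<sqinter> e b" and e_join: "e (a \<curlyvee> b) = e a \<squnion> e b"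
  and e_generates: "boolean_closure (range e) = UNIV"
  using R_generates unfolding R_generates_def by blast+

lemma e_le_iff: "e a \<le> e b \<longleftrightarrow> a \<preceq> b"
  using le_iff_meet[of a b] e_meet[of a b] inj_eq[OF e_inj] by (metis inf.absorb_iff1)

lemma inv_e: "inv e (e a) = a"
  using e_inj by simp

sublocale generating_sublattice "range e"
proof
  show "\<bottom> \<in> range e" "\<top> \<in> range e"
    using rangeI[of e \<zero>] rangeI[of e \<one>] by (simp_all add: e_zero e_one)
  show "x \<sqinter> y \<in> range e" "x \<squnion> y \<in> range e" if "x \<in> range e" "y \<in> range e" for x y
    using that by (auto simp flip: e_meet e_join)
qed (rule e_generates)

text \<open>The modular law required of the increments is exactly the MV law \<open>mv\<close>.
  Undefined sums become \<open>None\<close>, so definedness has to be recovered afterwards.\<close>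

sublocale val: lattice_valuation "range e" option_sum "Some \<zero>" "\<lambda>x y. Some (inv e y \<ominus> inv e x)"
proof -
  interpret comm_monoid option_sum "Some \<zero>" by (rule comm_monoid_option_sum)
  show "lattice_valuation (range e) option_sum (Some \<zero>) (\<lambda>x y. Some (inv e y \<ominus> inv e x))"
  proof
    fix x y w assume "x \<in> range e" "y \<in> range e"
    then obtain a b where ab: "x = e a" "y = e b" by blast
    show "Some (inv e (x \<squnion> y) \<ominus> inv e x) = Some (inv e y \<ominus> inv e (x \<sqinter> y))"
      by (simp add: ab inv_e mv flip: e_meet e_join)
    assume "w \<in> range e" "x \<le> y" "y \<le> w"
    then show "option_sum (Some (inv e y \<ominus> inv e x)) (Some (inv e w \<ominus> inv e y)) = Some (inv e w \<ominus> inv e x)"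
      using ab by (auto simp: inv_e e_le_iff ominus_oplus_ominus)
  next
    fix x assume "x \<in> range e"
    then show "Some (inv e x \<ominus> inv e x) = Some \<zero>" by (simp add: ominus_self)
  qed
qed

text \<open>The values of \<open>x\<close> and \<open>- x\<close> add up to
  \<open>Some \<one>\<close>, and \<open>None\<close> is absorbing, so neither of them can be
  \<open>None\<close>.\<close>

lemma extension_neq_None: "val.extension x \<noteq> None"
proof -
  have "val.extension (x \<squnion> - x) = Some \<one>"
    using val.extension_diff[OF bot_mem top_mem] e_zero e_one inv_e[of \<zero>] inv_e[of \<one>]
    by (simp add: ominus_zero diff_eq)
  moreover have "val.extension (x \<squnion> - x) = option_sum (val.extension x) (val.extension (- x))"
    by (rule val.extension_sup) simp
  ultimately show ?thesis by (metis bind.bind_lzero option.distinct(1) option_sum_def)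
qed

abbreviation chain_sum :: "'a list \<Rightarrow> 'a option" where
  "chain_sum xs \<equiv> osum (map (\<lambda>i. xs ! (2 * i + 1) \<ominus> xs ! (2 * i)) [0..<length xs div 2])"

lemma chain_sum_Cons_Cons:
  "chain_sum (a # b # xs) = option_sum (Some (b \<ominus> a)) (chain_sum xs)"
proof -
  have "[0..<length (a # b # xs) div 2] = 0 # map Suc [0..<length xs div 2]"
    by (simp add: map_Suc_upt upt_conv_Cons)
  then show ?thesis
    by (simp add: option_sum_def comp_def)
qed

text \<open>The list is consumed two entries at a time. The second conjunct strengthens the
  induction: it keeps the rest of the chain disjoint from the first difference, as additivity
  requires.\<close>

lemma chain_sum_eq_extension:
  assumes "even (length xs)" "sorted_wrt (\<preceq>) xs"
  shows "val.extension (foldr sym_diff (map e xs) \<bottom>) = chain_sum xs \<and>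
    (\<forall>a. (\<forall>b\<in>set xs. a \<preceq> b) \<longrightarrow> foldr sym_diff (map e xs) \<bottom> \<le> - e a)"
  using assms
proof (induction xs rule: induct_list012)
  case 1
  then show ?case by (simp add: val.extension_bot)
next
  case (3 a b xs)
  let ?r = "foldr sym_diff (map e xs) \<bottom>"
  have IH: "val.extension ?r = chain_sum xs" "?r \<le> - e b" and "a \<preceq> b"
    using 3 by auto
  then have "e a \<le> e b" by (simp add: e_le_iff)
  then have eq: "sym_diff (e a) (sym_diff (e b) ?r) = e b - e a \<squnion> ?r" "(e b - e a) \<sqinter> ?r = \<bottom>"
    using IH(2) unfolding sym_diff_def stone by blast+
  have "val.extension (e b - e a \<squnion> ?r) = chain_sum (a # b # xs)"
    unfolding chain_sum_Cons_Cons val.extension_sup[OF eq(2)] IH(1)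
    using val.extension_diff[of "e a" "e b"] \<open>e a \<le> e b\<close> by (simp add: inv_e)
  moreover have "e b - e a \<squnion> ?r \<le> - e c" if "\<forall>d\<in>set (a # b # xs). c \<preceq> d" for c
  proof -
    have "e c \<le> e a" using that by (simp add: e_le_iff)
    then show ?thesis using \<open>e a \<le> e b\<close> IH(2) unfolding stone by blast
  qed
  ultimately show ?case using eq(1) by simp
qed simp

lemma foldr_sym_diff: "foldr sym_diff xs y = sym_diff (foldr sym_diff xs \<bottom>) (y :: 'b)"
proof (induction xs)
  case Nil
  show ?case unfolding foldr.simps id_apply sym_diff_def stone by blast
next
  case (Cons x xs)
  have "sym_diff x (sym_diff w y) = sym_diff (sym_diff x w) y" for w
    unfolding sym_diff_def stone by blast
  with Cons show ?case by simp
qed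

text \<open>A selected step from \<open>e a\<close> to \<open>e b\<close> appends \<open>a\<close>
  and \<open>b\<close> to the list; bounding all entries by the current upper end keeps it
  sorted.\<close>

lemma exists_chain_representation: "\<exists>xs. chain_representation xs x"
proof -
  have "\<exists>xs. chain_representation xs x \<and> (\<forall>a\<in>set xs. e a \<le> \<top>)"
  proof (rule chain_induct[where P = "\<lambda>q x. \<exists>xs. chain_representation xs x \<and> (\<forall>a\<in>set xs. e a \<le> q)"])
    show "\<exists>xs. chain_representation xs \<bottom> \<and> (\<forall>a\<in>set xs. e a \<le> \<bottom>)"
      by (intro exI[of _ "[]"]) (simp add: chain_representation_def)
  next
    fix q r x
    assume "q \<in> range e" "r \<in> range e" and le: "q \<le> r" "x \<le> q"
      and "\<exists>xs. chain_representation xs x \<and> (\<forall>a\<in>set xs. e a \<le> q)"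
    then obtain xs a b where xs: "chain_representation xs x" "\<forall>a\<in>set xs. e a \<le> q"
      and ab: "q = e a" "r = e b" by blast
    show "\<exists>xs. chain_representation xs x \<and> (\<forall>a\<in>set xs. e a \<le> r)"
      using xs le order_trans by blast
    have le_r: "\<forall>c\<in>set (xs @ [a, b]). e c \<le> r" using xs le ab order_trans by fastforce
    have "sym_diff x (sym_diff q (sym_diff r \<bottom>)) = x \<squnion> (r - q)"
      using le unfolding sym_diff_def stone by blast
    then have "foldr sym_diff (map e (xs @ [a, b])) \<bottom> = x \<squnion> (r - q)"
      using foldr_sym_diff[of "map e xs" "sym_diff q (sym_diff r \<bottom>)"] xs ab
      by (simp add: chain_representation_def)
    moreover have "sorted_wrt (\<preceq>) (xs @ [a, b])"
      using xs le le_r by (auto simp: chain_representation_def sorted_wrt_append e_le_iff ab)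
    ultimately have "chain_representation (xs @ [a, b]) (x \<squnion> (r - q))"
      using xs by (simp add: chain_representation_def)
    with le_r show "\<exists>xs. chain_representation xs (x \<squnion> (r - q)) \<and> (\<forall>a\<in>set xs. e a \<le> r)"
      by blast
  qed
  then show ?thesis by blast
qed

text \<open>Every chain representation computes the extension, which makes the description of
  \<open>\<phi> x\<close> unique and hands the additivity of the extension over to
  \<open>\<phi>\<close>.\<close>

lemma extension_eq_phi: "val.extension x = Some (\<phi> x)"
proof -
  obtain m where m: "val.extension x = Some m" using extension_neq_None by blast
  have *: "chain_sum xs = Some m" if "chain_representation xs x" for xs
    using that chain_sum_eq_extension m by (simp add: chain_representation_def)
  have "\<phi> x = m"
    unfolding phi_def using * exists_chain_representation[of x] by (intro the_equality) auto
  with m show ?thesis by simp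
qed

lemma phi_bot: "\<phi> \<bottom> = \<zero>"
  using extension_eq_phi[of \<bottom>] val.extension_bot by simp

lemma phi_diff:
  assumes "a \<preceq> b"
  shows "\<phi> (e b - e a) = b \<ominus> a"
  using extension_eq_phi[of "e b - e a"] val.extension_diff[of "e a" "e b"] assms
  by (simp add: e_le_iff inv_e)

lemma phi_sup: "x \<sqinter> y = \<bottom> \<Longrightarrow> \<phi> x \<oplus> \<phi> y = Some (\<phi> (x \<squnion> y))"
  using val.extension_sup[of x y] by (simp add: extension_eq_phi)

section \<open>Value-preserving isomorphisms between principal ideals of \<open>B(M)\<close>\<close>

definition phi_iso :: "'b \<Rightarrow> 'b \<Rightarrow> ('b \<Rightarrow> 'b) \<Rightarrow> ('b \<Rightarrow> 'b) \<Rightarrow> bool" where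
  "phi_iso x y f g \<longleftrightarrow>
    (\<forall>z\<le>x. f z \<le> y \<and> g (f z) = z \<and> \<phi> (f z) = \<phi> z) \<and> (\<forall>w\<le>y. g w \<le> x \<and> f (g w) = w) \<and>
    (\<forall>z\<le>x. \<forall>z'\<le>z. f z' \<le> f z) \<and> (\<forall>w\<le>y. \<forall>w'\<le>w. g w' \<le> g w)"

definition phi_equivalent :: "'b \<Rightarrow> 'b \<Rightarrow> bool"  (infix "\<approx>" 50) where
  "x \<approx> y \<longleftrightarrow> (\<exists>f g. phi_iso x y f g)"

text \<open>Preservation of \<open>\<phi>\<close> by \<open>g\<close> follows from that by
  \<open>f\<close> together with \<open>f (g w) = w\<close>.\<close>

lemma phi_equivalent_sym: "x \<approx> y \<Longrightarrow> y \<approx> x"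
proof -
  assume "x \<approx> y"
  then obtain f g where "phi_iso x y f g" by (auto simp: phi_equivalent_def)
  then have "phi_iso y x g f" unfolding phi_iso_def by metis
  then show ?thesis by (auto simp: phi_equivalent_def)
qed

lemma phi_equivalent_trans: "x \<approx> y \<Longrightarrow> y \<approx> z \<Longrightarrow> x \<approx> z"
proof -
  assume "x \<approx> y" "y \<approx> z"
  then obtain f g f' g' where "phi_iso x y f g" "phi_iso y z f' g'"
    by (auto simp: phi_equivalent_def)
  then have "phi_iso x z (f' \<circ> f) (g \<circ> g')" unfolding phi_iso_def comp_def by simp
  then show ?thesis by (auto simp: phi_equivalent_def)
qed

lemma phi_iso_bot:
  assumes "phi_iso x y f g"
  shows "f \<bottom> = \<bottom>"
proof -
  have g: "g \<bottom> \<le> x" "f (g \<bottom>) = \<bottom>" and mono: "\<And>z z'. z \<le> x \<Longrightarrow> z' \<le> z \<Longrightarrow> f z' \<le> f z"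
    using assms by (simp_all add: phi_iso_def)
  have "f \<bottom> \<le> f (g \<bottom>)" using mono[OF g(1)] by simp
  with g show ?thesis by (simp add: bot_unique)
qed

lemma phi_iso_top:
  assumes "phi_iso x y f g"
  shows "f x = y"
proof (rule order.antisym)
  have "g y \<le> x" "f (g y) = y" using assms by (simp_all add: phi_iso_def)
  then show "y \<le> f x" using assms order_refl[of x] unfolding phi_iso_def by metis
qed (use assms in \<open>simp add: phi_iso_def\<close>)

text \<open>An element below the disjoint union is split into its two parts, which are mapped
  separately. Since \<open>y\<close> and \<open>y'\<close> are disjoint, the parts of an image are
  recovered by meets, and \<open>\<phi>\<close> is additive on them.\<close>

lemma phi_iso_sup:
  assumes 1: "phi_iso x y f g" and 2: "phi_iso x' y' f' g'"
    and disj: "x \<sqinter> x' = \<bottom>" "y \<sqinter> y' = \<bottom>"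
  shows "phi_iso (x \<squnion> x') (y \<squnion> y') (\<lambda>z. f (z \<sqinter> x) \<squnion> f' (z \<sqinter> x')) (\<lambda>w. g (w \<sqinter> y) \<squnion> g' (w \<sqinter> y'))"
proof -
  let ?f = "\<lambda>z. f (z \<sqinter> x) \<squnion> f' (z \<sqinter> x')" and ?g = "\<lambda>w. g (w \<sqinter> y) \<squnion> g' (w \<sqinter> y')"
  have f: "f (z \<sqinter> x) \<le> y" "f' (z \<sqinter> x') \<le> y'" "g (f (z \<sqinter> x)) = z \<sqinter> x" "g' (f' (z \<sqinter> x')) = z \<sqinter> x'"
    "\<phi> (f (z \<sqinter> x)) = \<phi> (z \<sqinter> x)" "\<phi> (f' (z \<sqinter> x')) = \<phi> (z \<sqinter> x')" for z
    using 1 2 unfolding phi_iso_def by simp_all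
  have g: "g (w \<sqinter> y) \<le> x" "g' (w \<sqinter> y') \<le> x'" "f (g (w \<sqinter> y)) = w \<sqinter> y" "f' (g' (w \<sqinter> y')) = w \<sqinter> y'" for w
    using 1 2 unfolding phi_iso_def by simp_all
  have "?f z \<le> y \<squnion> y' \<and> ?g (?f z) = z \<and> \<phi> (?f z) = \<phi> z" if "z \<le> x \<squnion> x'" for z
  proof -
    have "?f z \<sqinter> y = f (z \<sqinter> x)" "?f z \<sqinter> y' = f' (z \<sqinter> x')"
      using disj f(1,2)[of z] unfolding stone by blast+
    moreover have z: "z \<sqinter> x \<squnion> z \<sqinter> x' = z" using that unfolding stone by blast
    moreover have "?f z \<le> y \<squnion> y'" using f(1,2)[of z] unfolding stone by blast
    moreover have "z \<sqinter> x \<sqinter> (z \<sqinter> x') = \<bottom>" "f (z \<sqinter> x) \<sqinter> f' (z \<sqinter> x') = \<bottom>"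
      using f(1,2)[of z] disj unfolding stone by blast+
    then have "\<phi> (?f z) = \<phi> z"
      using phi_sup[of "z \<sqinter> x" "z \<sqinter> x'"] phi_sup[of "f (z \<sqinter> x)" "f' (z \<sqinter> x')"] z f(5,6) by simp
    ultimately show ?thesis by (simp add: f(3,4))
  qed
  moreover have "?g w \<le> x \<squnion> x' \<and> ?f (?g w) = w" if "w \<le> y \<squnion> y'" for w
  proof -
    have "?g w \<sqinter> x = g (w \<sqinter> y)" "?g w \<sqinter> x' = g' (w \<sqinter> y')"
      using disj g(1,2)[of w] unfolding stone by blast+
    moreover have "w \<sqinter> y \<squnion> w \<sqinter> y' = w" using that unfolding stone by blast
    moreover have "?g w \<le> x \<squnion> x'" using g(1,2)[of w] unfolding stone by blast
    ultimately show ?thesis by (simp add: g(3,4))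
  qed
  moreover have "?f z' \<le> ?f z" if "z' \<le> z" for z z'
  proof (rule sup_mono)
    have "z' \<sqinter> x \<le> z \<sqinter> x" "z' \<sqinter> x' \<le> z \<sqinter> x'" using that by (auto intro: le_infI1)
    with 1 2 show "f (z' \<sqinter> x) \<le> f (z \<sqinter> x)" "f' (z' \<sqinter> x') \<le> f' (z \<sqinter> x')"
      unfolding phi_iso_def by simp_all
  qed
  moreover have "?g w' \<le> ?g w" if "w' \<le> w" for w w'
  proof (rule sup_mono)
    have "w' \<sqinter> y \<le> w \<sqinter> y" "w' \<sqinter> y' \<le> w \<sqinter> y'" using that by (auto intro: le_infI1)
    with 1 2 show "g (w' \<sqinter> y) \<le> g (w \<sqinter> y)" "g' (w' \<sqinter> y') \<le> g' (w \<sqinter> y')"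
      unfolding phi_iso_def by simp_all
  qed
  ultimately show ?thesis unfolding phi_iso_def by blast
qed

lemma phi_equivalent_sup:
  assumes "x \<approx> y" "x' \<approx> y'" "x \<sqinter> x' = \<bottom>" "y \<sqinter> y' = \<bottom>"
  shows "x \<squnion> x' \<approx> y \<squnion> y'"
  using assms phi_iso_sup unfolding phi_equivalent_def by blast

text \<open>Gluing along \<open>u\<close> and \<open>- u\<close> yields an order automorphism of the
  whole algebra; it takes \<open>u\<close> to \<open>v\<close> because the second map fixes
  \<open>\<bottom>\<close>.\<close>

lemma exists_automorphism_if_phi_equivalent:
  assumes "u \<approx> v" "- u \<approx> - v"
  shows "\<exists>f\<in>G. v = f u"
proof -
  obtain f1 g1 f2 g2 where 1: "phi_iso u v f1 g1" and 2: "phi_iso (- u) (- v) f2 g2"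
    using assms by (auto simp: phi_equivalent_def)
  let ?f = "\<lambda>z. f1 (z \<sqinter> u) \<squnion> f2 (z \<sqinter> - u)" and ?g = "\<lambda>w. g1 (w \<sqinter> v) \<squnion> g2 (w \<sqinter> - v)"
  have iso: "phi_iso \<top> \<top> ?f ?g" using phi_iso_sup[OF 1 2] by simp
  have "boolean_automorphism ?f"
    by (rule boolean_automorphism_if_order_automorphism[of _ ?g])
      (use iso in \<open>simp_all add: phi_iso_def mono_def\<close>)
  moreover have "phi_preserving UNIV ?f"
    using iso by (simp add: phi_preserving_def phi_iso_def)
  ultimately have "?f \<in> G" by (simp add: G_def)
  moreover have "v = ?f u" using phi_iso_top[OF 1] phi_iso_bot[OF 2] by simp
  ultimately show ?thesis by (intro bexI[of _ ?f])
qed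

text \<open>\<open>H\<close> extends subtraction of \<open>a\<close> and \<open>K\<close> extends
  addition of \<open>a\<close>. Both maps are first made total on \<open>M\<close> by truncation,
  because \<open>hom_extension\<close> takes maps on the whole lattice.\<close>

lemma interval_equivalent:
  assumes "a \<preceq> b"
  shows "e b - e a \<approx> e (b \<ominus> a)"
proof -
  define clamp where "clamp t = (a \<curlyvee> t) \<curlywedge> b" for t
  define shift where "shift t = the (a \<oplus> (t \<curlywedge> (b \<ominus> a)))" for t
  define h where "h z = e (clamp (inv e z) \<ominus> a)" for z
  \<comment> \<open>Removing \<open>e a\<close> puts the values below
    \<open>e b - e a\<close>.\<close>
  define k where "k z = e (shift (inv e z)) - e a" for z
  have e_ab: "e a \<le> e b" using assms by (simp add: e_le_iff)
  have clamp: "a \<preceq> clamp t" "clamp t \<preceq> b" for t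
    unfolding clamp_def by (auto intro: le_meet le_join assms meet_le)
  have e_clamp: "e (clamp t) = (e a \<squnion> e t) \<sqinter> e b" for t
    by (simp add: clamp_def e_meet e_join)
  have shift: "a \<oplus> (t \<curlywedge> (b \<ominus> a)) = Some (shift t)" "a \<preceq> shift t" "shift t \<preceq> b"
    "shift t \<ominus> a = t \<curlywedge> (b \<ominus> a)" for t
    using le_ominusE[OF assms meet_le(2)[of t "b \<ominus> a"]] unfolding shift_def by (metis option.sel)+
  have clamp_shift: "clamp (shift t) = shift t" for t
    using shift(2,3)[of t] e_clamp[of "shift t"] e_le_iff inj_eq[OF e_inj]
    by (metis inf.absorb1 sup.absorb2)
  have shift_eqI: "shift t = s" if "a \<preceq> s" "s \<ominus> a = t \<curlywedge> (b \<ominus> a)" for s t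
    using oplus_ominus[OF that(1)] shift(1)[of t] that(2) by simp
  have shift_clamp: "shift (clamp t \<ominus> a) = clamp t" for t
  proof (rule shift_eqI)
    have "clamp t \<ominus> a \<preceq> b \<ominus> a" using clamp assms by (simp add: ominus_le_iff)
    then show "clamp t \<ominus> a = (clamp t \<ominus> a) \<curlywedge> (b \<ominus> a)" by (simp add: le_iff_meet)
  qed (rule clamp)

  have h_sup: "h (x \<squnion> y) = h x \<squnion> h y" and h_inf: "h (x \<sqinter> y) = h x \<sqinter> h y"
    if xy: "x \<in> range e" "y \<in> range e" for x y
  proof -
    obtain s t where st: "x = e s" "y = e t" using xy by blast
    \<comment> \<open>Distributivity of \<open>M\<close> is obtained by computing in the Boolean
      algebra and returning through the injectivity of \<open>e\<close>.\<close>
    have "e (clamp (s \<curlyvee> t)) = e (clamp s \<curlyvee> clamp t)" "e (clamp (s \<curlywedge> t)) = e (clamp s \<curlywedge> clamp t)"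
      unfolding e_join e_clamp e_meet unfolding stone by blast+
    then have "clamp (s \<curlyvee> t) = clamp s \<curlyvee> clamp t" "clamp (s \<curlywedge> t) = clamp s \<curlywedge> clamp t"
      by (simp_all add: inj_eq[OF e_inj])
    then show "h (x \<squnion> y) = h x \<squnion> h y" "h (x \<sqinter> y) = h x \<sqinter> h y"
      by (simp_all add: h_def st inv_e ominus_join ominus_meet clamp flip: e_join e_meet)
  qed
  obtain H where H: "H \<bottom> = \<bottom>"
    "\<And>x y. x \<in> range e \<Longrightarrow> y \<in> range e \<Longrightarrow> x \<le> y \<Longrightarrow> H (y - x) = h y - h x"
    "\<And>x y. H (x \<squnion> y) = H x \<squnion> H y"
    using hom_extension[of h, OF h_sup h_inf] by blast

  have k_sup: "k (x \<squnion> y) = k x \<squnion> k y" and k_inf: "k (x \<sqinter> y) = k x \<sqinter> k y"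
    if xy: "x \<in> range e" "y \<in> range e" for x y
  proof -
    obtain s t where st: "x = e s" "y = e t" using xy by blast
    let ?c = "b \<ominus> a"
    have "e ((s \<curlyvee> t) \<curlywedge> ?c) = e ((s \<curlywedge> ?c) \<curlyvee> (t \<curlywedge> ?c))" "e ((s \<curlywedge> t) \<curlywedge> ?c) = e ((s \<curlywedge> ?c) \<curlywedge> (t \<curlywedge> ?c))"
      unfolding e_join e_meet unfolding stone by blast+
    then have "(s \<curlyvee> t) \<curlywedge> ?c = (s \<curlywedge> ?c) \<curlyvee> (t \<curlywedge> ?c)" "(s \<curlywedge> t) \<curlywedge> ?c = (s \<curlywedge> ?c) \<curlywedge> (t \<curlywedge> ?c)"
      by (simp_all add: inj_eq[OF e_inj])
    then have "shift (s \<curlyvee> t) = shift s \<curlyvee> shift t" "shift (s \<curlywedge> t) = shift s \<curlywedge> shift t"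
      using shift le_trans[OF shift(2)[of s] le_join(1)]
      by (auto intro!: shift_eqI simp: ominus_join ominus_meet le_meet)
    then have "k (x \<squnion> y) = e (shift s) \<squnion> e (shift t) - e a" "k (x \<sqinter> y) = e (shift s) \<sqinter> e (shift t) - e a"
      unfolding k_def st by (simp_all add: inv_e flip: e_join e_meet)
    then show "k (x \<squnion> y) = k x \<squnion> k y" "k (x \<sqinter> y) = k x \<sqinter> k y"
      unfolding k_def st inv_e unfolding stone by blast+
  qed
  obtain K where K: "K \<bottom> = \<bottom>"
    "\<And>x y. x \<in> range e \<Longrightarrow> y \<in> range e \<Longrightarrow> x \<le> y \<Longrightarrow> K (y - x) = k y - k x"
    "\<And>x y. K (x \<squnion> y) = K x \<squnion> K y"
    using hom_extension[of k, OF k_sup k_inf] by blast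

  have mono: "H x \<le> H y" "K x \<le> K y" if "x \<le> y" for x y
    using that H(3)[of x y] K(3)[of x y] by (auto simp: sup.absorb2 sup.absorb_iff2)
  have h_mono: "h x \<le> h y" if "x \<le> y" "x \<in> range e" "y \<in> range e" for x y
    using that h_sup by (metis sup.absorb_iff2)

  \<comment> \<open>The meet allows a statement about all \<open>z\<close>; the steps of a chain
    need not lie below \<open>e b - e a\<close>.\<close>
  have KH: "K (H z) = z \<sqinter> (e b - e a)" for z
  proof (rule chain_induct[where P = "\<lambda>_ z. K (H z) = z \<sqinter> (e b - e a)"])
    fix q r z
    assume mem: "q \<in> range e" "r \<in> range e" and le: "q \<le> r" and IH: "K (H z) = z \<sqinter> (e b - e a)"
    obtain s t where st: "q = e s" "r = e t" using mem by blast
    have "K (H (r - q)) = k (h r) - k (h q)"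
      using h_mono[OF le mem] by (simp add: H(2) K(2) mem le h_def)
    also have "\<dots> = (e (clamp t) - e a) - (e (clamp s) - e a)"
      by (simp add: k_def h_def st inv_e shift_clamp)
    also have "\<dots> = (r - q) \<sqinter> (e b - e a)"
      unfolding e_clamp st unfolding stone by blast
    finally have "K (H (z \<squnion> (r - q))) = z \<sqinter> (e b - e a) \<squnion> (r - q) \<sqinter> (e b - e a)"
      by (simp add: H(3) K(3) IH)
    also have "\<dots> = (z \<squnion> (r - q)) \<sqinter> (e b - e a)" unfolding stone by blast
    finally show "K (H (z \<squnion> (r - q))) = (z \<squnion> (r - q)) \<sqinter> (e b - e a)" .
  qed (simp_all add: H K)

  have HK: "H (K w) = w \<sqinter> e (b \<ominus> a)" for w
  proof (rule chain_induct[where P = "\<lambda>_ w. H (K w) = w \<sqinter> e (b \<ominus> a)"])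
    fix q r w
    assume mem: "q \<in> range e" "r \<in> range e" and le: "q \<le> r" and IH: "H (K w) = w \<sqinter> e (b \<ominus> a)"
    obtain s t where st: "q = e s" "r = e t" using mem by blast
    have "s \<curlyvee> t = t" using le st e_join[of s t] inj_eq[OF e_inj] by (metis sup.absorb2)
    have "(s \<curlywedge> (b \<ominus> a)) \<preceq> (t \<curlywedge> (b \<ominus> a))"
      using le st by (auto simp: e_meet intro: le_infI1 simp flip: e_le_iff)
    then have shift_le: "shift s \<preceq> shift t"
      using ominus_le_iff[of a "shift s" "shift t"] shift by simp
    have "K (r - q) = (e (shift t) - e a) - (e (shift s) - e a)"
      using K(2)[OF mem le] by (simp add: k_def st inv_e)
    also have "\<dots> = e (shift t) - e (shift s)"
      using shift(2)[of s] unfolding e_le_iff[symmetric] unfolding stone by blast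
    finally have "H (K (r - q)) = h (e (shift t)) - h (e (shift s))"
      using shift_le by (simp add: H(2) e_le_iff)
    also have "\<dots> = (r \<sqinter> e (b \<ominus> a)) - (q \<sqinter> e (b \<ominus> a))"
      by (simp add: h_def inv_e clamp_shift shift(4) e_meet st)
    finally have "H (K (w \<squnion> (r - q))) = w \<sqinter> e (b \<ominus> a) \<squnion> ((r \<sqinter> e (b \<ominus> a)) - (q \<sqinter> e (b \<ominus> a)))"
      by (simp add: H(3) K(3) IH)
    also have "\<dots> = (w \<squnion> (r - q)) \<sqinter> e (b \<ominus> a)" unfolding stone by blast
    finally show "H (K (w \<squnion> (r - q))) = (w \<squnion> (r - q)) \<sqinter> e (b \<ominus> a)" .
  qed (simp_all add: H K)

  have phi_H: "\<phi> (H z) = \<phi> (z \<sqinter> (e b - e a))" for z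
  proof (rule chain_induct[where P = "\<lambda>_ z. \<phi> (H z) = \<phi> (z \<sqinter> (e b - e a))"])
    fix q r z
    assume mem: "q \<in> range e" "r \<in> range e" and le: "q \<le> r" "z \<le> q"
      and IH: "\<phi> (H z) = \<phi> (z \<sqinter> (e b - e a))"
    obtain s t where st: "q = e s" "r = e t" using mem by blast
    have "e (clamp s) \<le> e (clamp t)"
      using le(1) unfolding e_clamp st unfolding stone by blast
    then have "clamp s \<preceq> clamp t" by (simp add: e_le_iff)
    \<comment> \<open>Subtracting \<open>a\<close> from both ends does not change a difference, so a
      step has the same value before and after \<open>H\<close>.\<close>
    then have "\<phi> (e (clamp t) - e (clamp s)) = clamp t \<ominus> clamp s"
      "\<phi> (h r - h q) = clamp t \<ominus> clamp s"
      using clamp phi_diff[of "clamp s \<ominus> a" "clamp t \<ominus> a"] ominus_le_iff[of a "clamp s" "clamp t"]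
        ominus_eq[OF ominus_oplus_ominus[of a "clamp s" "clamp t"]]
      by (simp_all add: phi_diff h_def st inv_e)
    \<comment> \<open>Since \<open>z\<close> lies below \<open>q\<close>, its image lies below
      \<open>h q\<close> and misses the new increment.\<close>
    moreover have "H z \<sqinter> (h r - h q) = \<bottom>"
    proof -
      have "H z \<le> h q - h \<bottom>"
        using mono(1)[OF le(2)] H(2)[OF bot_mem mem(1)] by (simp add: diff_eq)
      then show ?thesis unfolding stone by blast
    qed
    moreover have "(z \<sqinter> (e b - e a)) \<sqinter> (e (clamp t) - e (clamp s)) = \<bottom>"
      "(z \<squnion> (r - q)) \<sqinter> (e b - e a) = (z \<sqinter> (e b - e a)) \<squnion> (e (clamp t) - e (clamp s))"
      using le unfolding st e_clamp unfolding stone by blast+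
    moreover have "H (z \<squnion> (r - q)) = H z \<squnion> (h r - h q)"
      by (simp add: H(2,3) mem le)
    ultimately show "\<phi> (H (z \<squnion> (r - q))) = \<phi> ((z \<squnion> (r - q)) \<sqinter> (e b - e a))"
      using phi_sup[of "H z" "h r - h q"] phi_sup[of "z \<sqinter> (e b - e a)" "e (clamp t) - e (clamp s)"] IH
      by simp
  qed (simp_all add: H)

  have H_le: "H z \<le> e (b \<ominus> a)" for z
  proof -
    have "e (clamp \<one>) = e b" unfolding e_clamp e_one by simp
    then have "clamp \<one> = b" by (simp add: inj_eq[OF e_inj])
    then have "H \<top> \<le> e (b \<ominus> a)"
      using H(2)[OF bot_mem top_mem] inv_e[of \<one>] by (simp add: e_one h_def diff_eq)
    with mono(1)[of z \<top>] show ?thesis by (auto intro: order_trans)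
  qed
  have K_le: "K w \<le> e b - e a" for w
  proof -
    have "k \<top> \<le> e b - e a"
      using shift(3)[of "inv e \<top>"] unfolding k_def e_le_iff[symmetric] unfolding stone by blast
    moreover have "K \<top> = k \<top> - k \<bottom>"
      using K(2)[OF bot_mem top_mem] by (simp add: diff_eq)
    ultimately have "K \<top> \<le> e b - e a" unfolding stone by blast
    with mono(2)[of w \<top>] show ?thesis by (auto intro: order_trans)
  qed
  have "phi_iso (e b - e a) (e (b \<ominus> a)) H K"
    unfolding phi_iso_def
    using H_le K_le KH HK phi_H mono by (simp add: inf.absorb1)
  then show ?thesis by (auto simp: phi_equivalent_def)
qed

text \<open>Induction along a chain for \<open>u\<close>. A new step with difference
  \<open>b \<ominus> a\<close> is matched with the interval of the same difference directly above
  \<open>\<phi> x\<close>, so the images stay disjoint and pile up to the new value.\<close>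

lemma equivalent_phi: "u \<approx> e (\<phi> u)"
proof (rule chain_induct[where P = "\<lambda>_ u. u \<approx> e (\<phi> u)"])
  have "phi_iso \<bottom> \<bottom> id id" by (simp add: phi_iso_def)
  then show "\<bottom> \<approx> e (\<phi> \<bottom>)" by (auto simp: phi_bot e_zero phi_equivalent_def)
next
  fix q r x
  assume "q \<in> range e" "r \<in> range e" "q \<le> r" "x \<le> q" and IH: "x \<approx> e (\<phi> x)"
  then obtain a b where ab: "q = e a" "r = e b" "a \<preceq> b" by (auto simp: e_le_iff)
  have disj: "x \<sqinter> (r - q) = \<bottom>" using \<open>x \<le> q\<close> unfolding stone by blast
  let ?m = "\<phi> (x \<squnion> (r - q))"
  have m: "\<phi> x \<oplus> (b \<ominus> a) = Some ?m"
    using phi_sup[OF disj] ab by (simp add: phi_diff)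
  then have le: "\<phi> x \<preceq> ?m" and eq: "?m \<ominus> \<phi> x = b \<ominus> a"
    using le_def ominus_eq by blast+
  have "r - q \<approx> e (b \<ominus> a)" using interval_equivalent ab by simp
  moreover have "e (b \<ominus> a) \<approx> e ?m - e (\<phi> x)"
    using phi_equivalent_sym[OF interval_equivalent[OF le]] eq by simp
  ultimately have "r - q \<approx> e ?m - e (\<phi> x)" by (rule phi_equivalent_trans)
  moreover have "e (\<phi> x) \<sqinter> (e ?m - e (\<phi> x)) = \<bottom>" unfolding stone by blast
  moreover have "e (\<phi> x) \<squnion> (e ?m - e (\<phi> x)) = e ?m"
    using le unfolding e_le_iff[symmetric] unfolding stone by blast
  ultimately show "x \<squnion> (r - q) \<approx> e ?m"
    using phi_equivalent_sup[OF IH _ disj] by metis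
qed simp

text \<open>In both cases the value of the complement is what completes the common value to
  \<open>\<phi> \<top>\<close>, so cancellation applies.\<close>

lemma phi_compl_eq:
  assumes "\<phi> u = \<phi> v"
  shows "\<phi> (- u) = \<phi> (- v)"
proof -
  have "\<phi> u \<oplus> \<phi> (- u) = Some (\<phi> \<top>)" "\<phi> v \<oplus> \<phi> (- v) = Some (\<phi> \<top>)"
    using phi_sup[of u "- u"] phi_sup[of v "- v"] by simp_all
  with assms cancel show ?thesis by metis
qed

lemma phi_eq_imp_equivalent: "\<phi> u = \<phi> v \<Longrightarrow> u \<approx> v"
  using equivalent_phi[of u] phi_equivalent_sym[OF equivalent_phi[of v]] phi_equivalent_trans
  by simp

lemma group_sim_G_iff: "group_sim G u v \<longleftrightarrow> \<phi> u = \<phi> v"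
proof
  assume "group_sim G u v"
  then show "\<phi> u = \<phi> v" by (auto simp: group_sim_def G_def phi_preserving_def)
next
  assume "\<phi> u = \<phi> v"
  then show "group_sim G u v"
    unfolding group_sim_def
    using exists_automorphism_if_phi_equivalent phi_eq_imp_equivalent phi_compl_eq by blast
qed

end

theorem corollary4p8:
  fixes oplus :: "'a \<Rightarrow> 'a \<Rightarrow> 'a option"
    and zero one :: 'a
    and e :: "'a \<Rightarrow> 'b::boolean_algebra"
  assumes "mv_effect_algebra_R_generated oplus zero one e"
  shows "\<forall>u v. group_sim (mv_effect_algebra_R_generated.G oplus zero e) u v \<longleftrightarrow>
    mv_effect_algebra_R_generated.phi oplus zero e u =
    mv_effect_algebra_R_generated.phi oplus zero e v"
proof -
  interpret mv_effect_algebra_R_generated oplus zero one e by fact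
  show ?thesis by (simp add: group_sim_G_iff)
qed

end
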